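(* Let $\mu$ be a nontrivial probability measure on $\partial\mathbb{D}$ with Verblunsky coefficients $\{\alpha_j\}_{j=0}^\infty$, and write $d\mu = w(\theta)\frac{d\theta}{2\pi} + d\mu_{\mathrm{s}}$ with $d\mu_{\mathrm{s}}$ singular with respect to $d\theta$. Then $$\sum_{j=0}^\infty |\alpha_{j+1}-\alpha_j|^2 + \sum_{j=0}^\infty |\alpha_j|^4 < \infty \iff \int_0^{2\pi} (1-\cos\theta)\log(w(\theta))\,\frac{d\theta}{2\pi} > -\infty .$$
   Context: $\mathbb{D}=\{z\in\mathbb{C} : |z|<1\}$. A probability measure on $\partial\mathbb{D}$ is nontrivial if it is not a finite combination of delta functions. For such $\mu$, $\Phi_n(z)$ is the monic orthogonal polynomial of degree $n$ in $L^2(\partial\mathbb{D},d\mu)$, and the Verblunsky coefficients are $\alpha_n=-\overline{\Phi_{n+1}(0)}\in\mathbb{D}$, $n\ge 0$. By Verblunsky's theorem, $\mu\mapsto\{\alpha_n\}_{n=0}^\infty$ is a bijection between nontrivial probability measures on $\partial\mathbb{D}$ and sequences in $\mathbb{D}$. *)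

theory Defs
  imports "HOL-Analysis.Analysis" "HOL-Probability.Probability"
    "HOL-Computational_Algebra.Polynomial"
begin

definition circle_borel :: "complex measure" where
  "circle_borel = restrict_space borel (sphere 0 1)"

definition circle_prob :: "complex measure \<Rightarrow> bool" where
  "circle_prob \<mu> \<longleftrightarrow>
     prob_space \<mu> \<and> space \<mu> = space circle_borel \<and> sets \<mu> = sets circle_borel"

definition finite_delta_combination :: "complex measure \<Rightarrow> bool" where
  "finite_delta_combination \<mu> \<longleftrightarrow>
     (\<exists>S c. finite S \<and> S \<subseteq> space \<mu> \<and>
        (\<forall>A\<in>sets \<mu>. emeasure \<mu> A = (\<Sum>z\<in>S. (c z :: ennreal) * indicator A z)))"

definition nontrivial_circle_prob :: "complex measure \<Rightarrow> bool" where
  "nontrivial_circle_prob \<mu> \<longleftrightarrow> circle_prob \<mu> \<and> \<not> finite_delta_combination \<mu>"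

definition inner_L2 :: "complex measure \<Rightarrow> (complex \<Rightarrow> complex) \<Rightarrow> (complex \<Rightarrow> complex) \<Rightarrow> complex" where
  "inner_L2 \<mu> f g = (\<integral>z. cnj (f z) * g z \<partial>\<mu>)"

definition is_monic_OP :: "complex measure \<Rightarrow> nat \<Rightarrow> complex poly \<Rightarrow> bool" where
  "is_monic_OP \<mu> n p \<longleftrightarrow>
     degree p = n \<and> lead_coeff p = 1 \<and>
     (\<forall>k<n. inner_L2 \<mu> (\<lambda>z. z ^ k) (poly p) = 0)"

text \<open>For a nontrivial measure, monomials are linearly independent in \<open>L\<^sup>2(\<mu>)\<close>, so the
  polynomial described here exists and is unique.\<close>
definition monic_OP :: "complex measure \<Rightarrow> nat \<Rightarrow> complex poly" where
  "monic_OP \<mu> n = (THE p. is_monic_OP \<mu> n p)"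

definition verblunsky :: "complex measure \<Rightarrow> nat \<Rightarrow> complex" where
  "verblunsky \<mu> n = - cnj (poly (monic_OP \<mu> (Suc n)) 0)"

text \<open>The measure \<open>d\<theta>/2\<pi>\<close> on \<open>[0,2\<pi>)\<close>; \<open>uniform_measure\<close> divides by the total mass \<open>2\<pi>\<close>.\<close>
definition angle_measure :: "real measure" where
  "angle_measure = uniform_measure lborel {0..<2 * pi}"

text \<open>The measure \<open>w(\<theta>) d\<theta>/2\<pi>\<close>, transported to the unit circle by \<open>\<theta> \<mapsto> e\<^sup>i\<^sup>\<theta>\<close>.\<close>
definition circle_ac :: "(real \<Rightarrow> real) \<Rightarrow> complex measure" where
  "circle_ac w = distr (density angle_measure (\<lambda>\<theta>. ennreal (w \<theta>))) circle_borel cis"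

definition mutually_singular :: "'a measure \<Rightarrow> 'a measure \<Rightarrow> bool" where
  "mutually_singular M N \<longleftrightarrow>
     sets M = sets N \<and>
     (\<exists>A\<in>sets M. emeasure M A = 0 \<and> emeasure N (space N - A) = 0)"

text \<open>\<open>circle_ac (\<lambda>_. 1)\<close> is normalized arc length \<open>d\<theta>/2\<pi>\<close> on the circle.\<close>
definition circle_Lebesgue_decomposition ::
    "complex measure \<Rightarrow> (real \<Rightarrow> real) \<Rightarrow> complex measure \<Rightarrow> bool" where
  "circle_Lebesgue_decomposition \<mu> w \<mu>\<^sub>s \<longleftrightarrow>
     w \<in> borel_measurable borel \<and> (\<forall>\<theta>\<in>{0..<2 * pi}. 0 \<le> w \<theta>) \<and>
     space \<mu>\<^sub>s = space circle_borel \<and> sets \<mu>\<^sub>s = sets circle_borel \<and>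
     mutually_singular \<mu>\<^sub>s (circle_ac (\<lambda>_. 1)) \<and>
     (\<forall>A\<in>sets \<mu>. emeasure \<mu> A = emeasure (circle_ac w) A + emeasure \<mu>\<^sub>s A)"

text \<open>Since \<open>ln 0 = 0\<close> for real numbers in HOL, the convention \<open>log 0 = -\<infinity>\<close> needs an
  extended-valued logarithm: otherwise a weight vanishing on a set of positive measure could
  have a finite logarithmic integral.\<close>
definition ext_log :: "real \<Rightarrow> ereal" where
  "ext_log x = (if x \<le> 0 then - \<infinity> else ereal (ln x))"

text \<open>Integral of an extended-real function as the difference of the integrals of its positive
  and negative parts (\<open>e2ennreal\<close> sends negative arguments to \<open>0\<close>). It is meaningful when at
  least one of the two is finite; for \<open>(1 - cos \<theta>) log w(\<theta>)\<close> the positive part is at most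
  \<open>2 w(\<theta>)\<close>, hence integrable.\<close>
definition ext_integral :: "'a measure \<Rightarrow> ('a \<Rightarrow> ereal) \<Rightarrow> ereal" where
  "ext_integral M f =
     enn2ereal (\<integral>\<^sup>+x. e2ennreal (f x) \<partial>M) - enn2ereal (\<integral>\<^sup>+x. e2ennreal (- f x) \<partial>M)"

end

theory Submission
  imports Defs "HOL-Complex_Analysis.Complex_Analysis"
begin

text \<open>
  Let \<open>w\<^sub>n = \<parallel>\<Phi>\<^sub>n\<parallel>\<^sup>2 / |\<Phi>\<^sub>n|\<^sup>2\<close> be the Bernstein-Szego weight.
  The reversed polynomial \<open>\<Phi>\<^sub>n\<^sup>*\<close> has no zeros in the closed disk, so Cauchy's formula for
  \<open>log \<Phi>\<^sub>n\<^sup>*\<close> and the Szego recursion evaluate \<open>Z\<^sub>n = \<integral>(1 - cos \<theta>) log w\<^sub>n d\<theta>/2\<pi>\<close> as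
  \<open>\<Sum>\<^sub>j\<^sub><\<^sub>n (log(1 - |\<alpha>\<^sub>j|\<^sup>2) + |\<alpha>\<^sub>j|\<^sup>2) - \<Sum> |\<alpha>\<^sub>j\<^sub>+\<^sub>1 - \<alpha>\<^sub>j|\<^sup>2 / 2 + O(1)\<close>.
  Hence both series converge iff \<open>Z\<^sub>n\<close> is bounded below.

  If the logarithmic integral \<open>Z\<close> of \<open>w\<close> is finite, \<open>log x \<le> x - 1\<close> at \<open>x = w / w\<^sub>n\<close> gives \<open>Z \<le> Z\<^sub>n + 1\<close>.
  Conversely, the same inequality at \<open>x = f w\<^sub>n\<close> gives
  \<open>1 + \<integral>(1 - cos \<theta>) log f d\<theta>/2\<pi> + Z\<^sub>n \<le> 2 \<integral> f w\<^sub>n d\<theta>/2\<pi>\<close> for positive \<open>f\<close>. The measures \<open>w\<^sub>n d\<theta>/2\<pi>\<close> share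
  their first \<open>n\<close> moments with \<open>\<mu>\<close>, so by density
  \<open>\<mu>\<close> may replace them on the right when \<open>Z\<^sub>n\<close> is bounded below;
  taking for \<open>f\<close> truncations of \<open>1/w\<close>, made small on the support of the singular part, bounds \<open>Z\<close> below.
\<close>

subsection \<open>The Szego recursion\<close>

text \<open>The pair \<open>(\<Phi>\<^sub>n, \<Phi>\<^sub>n\<^sup>*)\<close> with \<open>\<Phi>\<^sub>n\<^sup>*(z) = z\<^sup>n cnj (\<Phi>\<^sub>n (1 / cnj z))\<close>.\<close>
primrec szego_pair :: "(nat \<Rightarrow> complex) \<Rightarrow> nat \<Rightarrow> complex poly \<times> complex poly" where
  "szego_pair a 0 = (1, 1)"
| "szego_pair a (Suc n) =
     (let (p, q) = szego_pair a n
      in (pCons 0 p - smult (cnj (a n)) q, q - smult (a n) (pCons 0 p)))"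

definition Phi :: "(nat \<Rightarrow> complex) \<Rightarrow> nat \<Rightarrow> complex poly" where
  "Phi a n = fst (szego_pair a n)"

definition Psi :: "(nat \<Rightarrow> complex) \<Rightarrow> nat \<Rightarrow> complex poly" where
  "Psi a n = snd (szego_pair a n)"

lemma Phi_0 [simp]: "Phi a 0 = 1"
  and Psi_0 [simp]: "Psi a 0 = 1"
  and Phi_Suc: "Phi a (Suc n) = pCons 0 (Phi a n) - smult (cnj (a n)) (Psi a n)"
  and Psi_Suc: "Psi a (Suc n) = Psi a n - smult (a n) (pCons 0 (Phi a n))"
  by (simp_all add: Phi_def Psi_def case_prod_beta Let_def)

lemma degree_Phi: "degree (Phi a n) = n"
  and lead_coeff_Phi: "lead_coeff (Phi a n) = 1"
proof -
  \<comment> \<open>The three facts go through the induction together: the degree bound on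
    \<open>Psi\<close> is what protects the leading coefficient of \<open>Phi\<close> in the next
    step.\<close>
  have *: "degree (Phi a n) \<le> n \<and> coeff (Phi a n) n = 1 \<and> degree (Psi a n) \<le> n"
  proof (induction n)
    case (Suc n)
    have "degree (pCons 0 (Phi a n)) \<le> Suc n"
      using Suc degree_pCons_le[of 0 "Phi a n"] by linarith
    moreover have "degree (smult c (Psi a n)) \<le> Suc n" for c
      using Suc degree_smult_le[of c "Psi a n"] by linarith
    moreover have "degree (smult (a n) (pCons 0 (Phi a n))) \<le> Suc n"
      using Suc degree_pCons_le[of 0 "Phi a n"] degree_smult_le[of "a n" "pCons 0 (Phi a n)"] by linarith
    moreover have "coeff (Psi a n) (Suc n) = 0"
      using Suc by (intro coeff_eq_0) linarith
    ultimately have "degree (Phi a (Suc n)) \<le> Suc n" "coeff (Phi a (Suc n)) (Suc n) = 1"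
      "degree (Psi a (Suc n)) \<le> Suc n"
      unfolding Phi_Suc Psi_Suc using Suc le_SucI[of "degree (Psi a n)" n]
      by (blast intro: degree_diff_le, simp, blast intro: degree_diff_le)
    then show ?case by blast
  qed auto
  show "degree (Phi a n) = n" using * le_degree[of "Phi a n" n] by simp
  then show "lead_coeff (Phi a n) = 1" using * by simp
qed

lemma coeff_Psi_0 [simp]: "coeff (Psi a n) 0 = 1"
  by (induction n) (auto simp: Psi_Suc)

lemma coeff_Phi_Suc_0: "coeff (Phi a (Suc n)) 0 = - cnj (a n)"
  by (simp add: Phi_Suc)

text \<open>For positive n, \<open>coeff_Phi_Suc_0\<close> turns this into \<open>- a 0\<close> plus
  the products \<open>a (j + 1) * cnj (a j)\<close>, the source of the differences in the sum
  rule.\<close>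

lemma coeff_Psi_1: "coeff (Psi a n) 1 = - (\<Sum>j<n. a j * coeff (Phi a j) 0)"
  by (induction n) (auto simp: Psi_Suc)

text \<open>On the circle \<open>1 / cnj z = z\<close>, so reversal of a polynomial takes this form;
  conjugating the recursion for \<open>Phi\<close> and multiplying by \<open>z ^ Suc n\<close> gives
  the recursion for \<open>Psi\<close>.\<close>

lemma poly_Psi_eq_reflection:
  assumes "cmod z = 1"
  shows "poly (Psi a n) z = z ^ n * cnj (poly (Phi a n) z)"
proof (induction n)
  case (Suc n)
  have z: "z * cnj z = 1" using assms by (simp add: complex_norm_square[symmetric])
  have zn: "z ^ n * cnj z ^ n = 1" using z by (metis power_mult_distrib power_one)
  have "z ^ Suc n * cnj (poly (Phi a (Suc n)) z) =
    (z * cnj z) * (z ^ n * cnj (poly (Phi a n) z)) - a n * z * (z ^ n * cnj z ^ n) * poly (Phi a n) z"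
    using Suc by (simp add: Phi_Suc algebra_simps)
  then show ?case using Suc z zn by (simp add: Psi_Suc algebra_simps)
qed auto

lemma cmod_Psi_eq_Phi: "cmod z = 1 \<Longrightarrow> cmod (poly (Psi a n) z) = cmod (poly (Phi a n) z)"
  by (simp add: poly_Psi_eq_reflection norm_mult norm_power)

text \<open>The recursion preserves the indefinite form |u|^2 - |v|^2 up to a factor: the cross
  terms of the two squares have equal real parts and cancel.\<close>

lemma cmod_szego_step:
  fixes u v b :: complex
  shows "(cmod (u - b * v))\<^sup>2 - (cmod (v - cnj b * u))\<^sup>2 = (1 - (cmod b)\<^sup>2) * ((cmod u)\<^sup>2 - (cmod v)\<^sup>2)"
proof -
  have "complex_of_real ((cmod (u - b * v))\<^sup>2 - (cmod (v - cnj b * u))\<^sup>2) =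
    complex_of_real ((1 - (cmod b)\<^sup>2) * ((cmod u)\<^sup>2 - (cmod v)\<^sup>2))"
    by (simp only: of_real_diff of_real_mult of_real_1 complex_norm_square)
       (simp add: algebra_simps)
  then show ?thesis using of_real_eq_iff by blast
qed

text \<open>The induction also carries |Phi_n| <= |Psi_n| on the closed disk. With
  \<open>cmod (a n) < 1\<close> this makes \<open>a n * v\<close> strictly smaller than
  \<open>u\<close>, and \<open>cmod_szego_step\<close> passes the inequality on.\<close>

lemma Psi_nonzero:
  assumes a: "\<And>n. cmod (a n) < 1" and z: "cmod z \<le> 1"
  shows "poly (Psi a n) z \<noteq> 0"
proof -
  have "cmod (poly (Phi a n) z) \<le> cmod (poly (Psi a n) z) \<and> poly (Psi a n) z \<noteq> 0"
  proof (induction n)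
    case (Suc n)
    define u where "u = poly (Psi a n) z"
    define v where "v = z * poly (Phi a n) z"
    have vu: "cmod v \<le> cmod u" unfolding u_def v_def norm_mult
      using Suc z by (meson mult_left_le_one_le norm_ge_zero order_trans)
    have u0: "cmod u > 0" using Suc by (simp add: u_def)
    have e: "poly (Phi a (Suc n)) z = v - cnj (a n) * u" "poly (Psi a (Suc n)) z = u - a n * v"
      by (simp_all add: Phi_Suc Psi_Suc u_def v_def)
    have "cmod (a n * v) < cmod u"
    proof (cases "v = 0")
      case False
      then have "cmod (a n * v) < 1 * cmod v" unfolding norm_mult
        using a by (intro mult_strict_right_mono) auto
      then show ?thesis using vu by simp
    qed (use u0 in auto)
    then have "u - a n * v \<noteq> 0" by auto
    moreover have "(cmod (v - cnj (a n) * u))\<^sup>2 \<le> (cmod (u - a n * v))\<^sup>2"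
    proof -
      have "(cmod (a n))\<^sup>2 \<le> 1" using a[of n] by (simp add: power_le_one)
      moreover have "(cmod v)\<^sup>2 \<le> (cmod u)\<^sup>2" using vu by (simp add: power_mono)
      ultimately have "0 \<le> (1 - (cmod (a n))\<^sup>2) * ((cmod u)\<^sup>2 - (cmod v)\<^sup>2)" by simp
      then show ?thesis using cmod_szego_step[of u "a n" v] by linarith
    qed
    ultimately show ?case unfolding e using power2_le_imp_le norm_ge_zero by blast
  qed auto
  then show ?thesis by simp
qed

lemma Phi_nonzero_circle:
  assumes "\<And>n. cmod (a n) < 1" and "cmod z = 1"
  shows "poly (Phi a n) z \<noteq> 0"
  using Psi_nonzero[of a z n, OF assms(1)] cmod_Psi_eq_Phi[OF assms(2), of a n] assms(2) by auto

text \<open>The recursion solved backwards: eliminating \<open>Psi a n\<close> between the two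
  update formulas recovers z Phi_n from level n + 1.\<close>

lemma smult_pCons_Phi:
  "smult (of_real (1 - (cmod (a n))\<^sup>2)) (pCons 0 (Phi a n)) = Phi a (Suc n) + smult (cnj (a n)) (Psi a (Suc n))"
  unfolding of_real_diff of_real_1 complex_norm_square
  by (simp add: Phi_Suc Psi_Suc algebra_simps smult_diff_right smult_diff_left)

section \<open>Orthogonality relations for finite measures on the circle\<close>

locale circle_measure = finite_measure M for M :: "complex measure" +
  assumes sets_M: "sets M = sets circle_borel"
begin

lemma space_M: "space M = sphere 0 1"
  using sets_eq_imp_space_eq[OF sets_M] by (simp add: circle_borel_def space_restrict_space)

lemma cmod_space: "z \<in> space M \<Longrightarrow> cmod z = 1"
  by (simp add: space_M)

lemma measurable_M: "f \<in> borel_measurable borel \<Longrightarrow> f \<in> borel_measurable M"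
  using measurable_restrict_space1 measurable_cong_sets[OF sets_M refl] 
  by (metis circle_borel_def)

lemma integrable_continuous:
  fixes f :: "complex \<Rightarrow> 'b::{banach, second_countable_topology}"
  assumes "continuous_on (sphere 0 1) f"
  shows "integrable M f"
proof -
  have m: "f \<in> borel_measurable M"
    using borel_measurable_continuous_on_restrict[OF assms] measurable_cong_sets[OF sets_M refl]
    by (metis circle_borel_def)
  have "bounded (f ` sphere 0 1)"
    by (intro compact_imp_bounded compact_continuous_image assms compact_sphere)
  then obtain B where "\<And>z. z \<in> sphere 0 1 \<Longrightarrow> norm (f z) \<le> B"
    unfolding bounded_iff by blast
  then show ?thesis using m by (intro integrable_const_bound[where B=B]) (auto simp: space_M)
qed

lemma integrable_ip:
  "integrable M (\<lambda>z. cnj (z ^ k) * poly q z)"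
  by (intro integrable_continuous continuous_intros)

lemma ip_shift:
  "inner_L2 M (\<lambda>z. z ^ Suc k) (\<lambda>z. z * f z) = inner_L2 M (\<lambda>z. z ^ k) f"
  unfolding inner_L2_def
proof (rule Bochner_Integration.integral_cong[OF refl])
  fix z assume "z \<in> space M"
  then have "z * cnj z = 1" using cmod_space by (simp add: complex_norm_square[symmetric])
  moreover have "cnj (z ^ Suc k) * (z * f z) = (z * cnj z) * (cnj (z ^ k) * f z)"
    by simp
  ultimately show "cnj (z ^ Suc k) * (z * f z) = cnj (z ^ k) * f z" by (simp only: mult_1)
qed

lemma ip_add: "inner_L2 M (\<lambda>z. z ^ k) (poly (p + q)) =
    inner_L2 M (\<lambda>z. z ^ k) (poly p) + inner_L2 M (\<lambda>z. z ^ k) (poly q)"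
  unfolding inner_L2_def poly_add distrib_left
  by (intro Bochner_Integration.integral_add integrable_ip)

lemma ip_diff: "inner_L2 M (\<lambda>z. z ^ k) (poly (p - q)) =
    inner_L2 M (\<lambda>z. z ^ k) (poly p) - inner_L2 M (\<lambda>z. z ^ k) (poly q)"
  unfolding inner_L2_def poly_diff right_diff_distrib
  by (intro Bochner_Integration.integral_diff integrable_ip)

lemma ip_smult: "inner_L2 M (\<lambda>z. z ^ k) (poly (smult c p)) =
    c * inner_L2 M (\<lambda>z. z ^ k) (poly p)"
  unfolding inner_L2_def poly_smult
  by (subst integral_mult_right_zero[symmetric]) (simp add: algebra_simps)

lemma ip_pCons: "inner_L2 M (\<lambda>z. z ^ Suc k) (poly (pCons 0 p)) = inner_L2 M (\<lambda>z. z ^ k) (poly p)"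
  using ip_shift[of k "poly p"] by (simp only: inner_L2_def poly_pCons add_0)

text \<open>By \<open>poly_Psi_eq_reflection\<close> the two integrands are conjugate on the circle.
  Orthogonality of Phi_n to 1, ..., z^(n-1) thereby becomes orthogonality of Psi_n to z, ...,
  z^n.\<close>

lemma ip_Psi:
  assumes "m \<le> n"
  shows "inner_L2 M (\<lambda>z. z ^ m) (poly (Psi a n)) = cnj (inner_L2 M (\<lambda>z. z ^ (n - m)) (poly (Phi a n)))"
proof -
  have "cnj (z ^ m) * poly (Psi a n) z = cnj (cnj (z ^ (n - m)) * poly (Phi a n) z)"
    if "z \<in> space M" for z
  proof -
    have z: "cmod z = 1" using that cmod_space by blast
    then have "z * cnj z = 1" by (simp add: complex_norm_square[symmetric])
    then have zn: "cnj z ^ m * z ^ m = 1" by (metis power_mult_distrib power_one mult.commute)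
    have "z ^ n = z ^ m * z ^ (n - m)" using assms by (simp add: power_add[symmetric])
    then have "cnj (z ^ m) * poly (Psi a n) z = (cnj z ^ m * z ^ m) * (z ^ (n - m) * cnj (poly (Phi a n) z))"
      using poly_Psi_eq_reflection[OF z, of a n] by simp
    then show ?thesis unfolding zn by simp
  qed
  then have "inner_L2 M (\<lambda>z. z ^ m) (poly (Psi a n)) = (\<integral>z. cnj (cnj (z ^ (n - m)) * poly (Phi a n) z) \<partial>M)"
    unfolding inner_L2_def by (intro Bochner_Integration.integral_cong refl)
  then show ?thesis unfolding inner_L2_def by (simp only: Bochner_Integration.integral_cnj)
qed

end

text \<open>For Verblunsky coefficients \<open>a\<close> of \<open>\<mu>\<close> this is \<open>\<parallel>\<Phi>\<^sub>n\<parallel>\<^sup>2\<close> in \<open>L\<^sup>2(\<mu>)\<close>.\<close>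
definition szego_norm :: "(nat \<Rightarrow> complex) \<Rightarrow> nat \<Rightarrow> real" where
  "szego_norm a n = (\<Prod>j<n. 1 - (cmod (a j))\<^sup>2)"

lemma szego_norm_pos:
  assumes "\<And>j. j < n \<Longrightarrow> cmod (a j) < 1"
  shows "szego_norm a n > 0"
  unfolding szego_norm_def using assms by (intro prod_pos) (simp add: abs_square_less_1)

lemma szego_pair_cong:
  assumes "\<And>j. j < n \<Longrightarrow> a j = b j"
  shows "szego_pair a n = szego_pair b n"
  using assms by (induction n) auto

text \<open>The case \<open>k = n\<close> records the norm: pairing z^n with a monic polynomial
  orthogonal to the lower powers gives its squared norm. Keeping \<open>a\<close> free lets the
  predicate apply to Bernstein-Szego measures too.\<close>

definition szego_orth :: "complex measure \<Rightarrow> (nat \<Rightarrow> complex) \<Rightarrow> nat \<Rightarrow> bool" where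
  "szego_orth M a n \<longleftrightarrow>
     (\<forall>k\<le>n. inner_L2 M (\<lambda>z. z ^ k) (poly (Phi a n)) = (if k = n then of_real (szego_norm a n) else 0))"

lemma poly_eq_sum_atMost:
  fixes p :: "'a::comm_semiring_1 poly"
  assumes "degree p \<le> n"
  shows "poly p z = (\<Sum>i\<le>n. coeff p i * z ^ i)"
  unfolding poly_altdef using assms
  by (intro sum.mono_neutral_left) (auto simp: coeff_eq_0)

context circle_measure
begin

text \<open>Pair \<open>smult_pCons_Phi\<close> with z^(k+1): the \<open>Psi\<close> term vanishes
  by \<open>ip_Psi\<close>, the \<open>Phi\<close> term survives only for k = n, and the nonzero
  factor 1 - |a n|^2 divides out. Bernstein-Szego measures are checked directly only at the top
  level and reach the lower ones this way.\<close>

lemma szego_orth_SucD: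
  assumes "szego_orth M a (Suc n)" "\<And>j. cmod (a j) < 1"
  shows "szego_orth M a n"
  unfolding szego_orth_def
proof (intro allI impI)
  fix k assume k: "k \<le> n"
  have "inner_L2 M (\<lambda>z. z ^ Suc k) (poly (Psi a (Suc n))) =
      cnj (inner_L2 M (\<lambda>z. z ^ (Suc n - Suc k)) (poly (Phi a (Suc n))))"
    using k by (intro ip_Psi) simp
  also have "\<dots> = 0"
    using assms(1)[unfolded szego_orth_def, rule_format, of "n - k"] by simp
  finally have psi: "inner_L2 M (\<lambda>z. z ^ Suc k) (poly (Psi a (Suc n))) = 0" .
  have "of_real (1 - (cmod (a n))\<^sup>2) * inner_L2 M (\<lambda>z. z ^ Suc k) (poly (pCons 0 (Phi a n)))
     = inner_L2 M (\<lambda>z. z ^ Suc k) (poly (Phi a (Suc n)))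
       + cnj (a n) * inner_L2 M (\<lambda>z. z ^ Suc k) (poly (Psi a (Suc n)))"
    unfolding ip_smult[symmetric] ip_add[symmetric] smult_pCons_Phi ..
  then have *: "of_real (1 - (cmod (a n))\<^sup>2) * inner_L2 M (\<lambda>z. z ^ k) (poly (Phi a n)) =
      (if k = n then of_real (szego_norm a (Suc n)) else 0)"
    using psi assms(1)[unfolded szego_orth_def, rule_format, of "Suc k"] k
    by (simp only: ip_pCons) simp
  have "1 - (cmod (a n))\<^sup>2 \<noteq> 0"
    using assms(2)[of n] by (metis abs_norm_cancel abs_square_less_1 eq_iff_diff_eq_0 less_irrefl)
  then have nz: "complex_of_real (1 - (cmod (a n))\<^sup>2) \<noteq> 0" by (simp only: of_real_eq_0_iff not_False_eq_True)
  have "complex_of_real (szego_norm a (Suc n)) = of_real (1 - (cmod (a n))\<^sup>2) * of_real (szego_norm a n)"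
    by (simp only: szego_norm_def prod.lessThan_Suc of_real_mult mult.commute)
  then show "inner_L2 M (\<lambda>z. z ^ k) (poly (Phi a n)) = (if k = n then of_real (szego_norm a n) else 0)"
    using * nz by (cases "k = n") (simp_all only: if_True if_False mult_cancel_left mult_eq_0_iff, auto)
qed

lemma szego_orth_le:
  assumes "szego_orth M a n" "\<And>j. cmod (a j) < 1" "m \<le> n"
  shows "szego_orth M a m"
  using assms(3,1) by (induction rule: inc_induct) (auto intro: szego_orth_SucD assms(2))

lemma ip_poly: 
  assumes "degree p \<le> n"
  shows "(\<integral>z. cnj (poly p z) * poly q z \<partial>M) = (\<Sum>i\<le>n. cnj (coeff p i) * inner_L2 M (\<lambda>z. z ^ i) (poly q))"
proof -
  have "cnj (poly p z) * poly q z = (\<Sum>i\<le>n. cnj (coeff p i) * (cnj (z ^ i) * poly q z))" for z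
    by (simp add: poly_eq_sum_atMost[OF assms] sum_distrib_right mult.assoc)
  then have "(\<integral>z. cnj (poly p z) * poly q z \<partial>M) = (\<integral>z. (\<Sum>i\<le>n. cnj (coeff p i) * (cnj (z ^ i) * poly q z)) \<partial>M)"
    by presburger
  also have "\<dots> = (\<Sum>i\<le>n. \<integral>z. cnj (coeff p i) * (cnj (z ^ i) * poly q z) \<partial>M)"
    by (intro Bochner_Integration.integral_sum integrable_continuous continuous_intros)
  finally show ?thesis by (simp add: inner_L2_def)
qed

lemma integral_poly:
  assumes "degree p \<le> n"
  shows "(\<integral>z. poly p z \<partial>M) = (\<Sum>i\<le>n. coeff p i * (\<integral>z. z ^ i \<partial>M))"
proof -
  have "poly p z = (\<Sum>i\<le>n. coeff p i * z ^ i)" for z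
    by (rule poly_eq_sum_atMost[OF assms])
  then have "(\<integral>z. poly p z \<partial>M) = (\<integral>z. (\<Sum>i\<le>n. coeff p i * z ^ i) \<partial>M)"
    by presburger
  also have "\<dots> = (\<Sum>i\<le>n. \<integral>z. coeff p i * z ^ i \<partial>M)"
    by (intro Bochner_Integration.integral_sum integrable_continuous continuous_intros)
  finally show ?thesis by simp
qed

text \<open>Pairing the monic \<open>Phi a n\<close> with 1 turns orthogonality into a recursion for
  the moments; at n = 0 it fixes the total mass as 1.\<close>

lemma moment_eq:
  assumes "szego_orth M a n"
  shows "(\<integral>z. z ^ n \<partial>M) = (if n = 0 then 1 else 0) - (\<Sum>i<n. coeff (Phi a n) i * (\<integral>z. z ^ i \<partial>M))"
proof -
  have "(\<integral>z. poly (Phi a n) z \<partial>M) = (if n = 0 then 1 else 0)"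
    using assms[unfolded szego_orth_def, rule_format, of 0] by (auto simp: inner_L2_def szego_norm_def)
  moreover have "(\<integral>z. poly (Phi a n) z \<partial>M) = (\<Sum>i\<le>n. coeff (Phi a n) i * (\<integral>z. z ^ i \<partial>M))"
    by (rule integral_poly) (simp add: degree_Phi)
  moreover have "coeff (Phi a n) n = 1" using lead_coeff_Phi[of a n] by (simp add: degree_Phi)
  ultimately have "(\<Sum>i<n. coeff (Phi a n) i * (\<integral>z. z ^ i \<partial>M)) + (\<integral>z. z ^ n \<partial>M) = (if n = 0 then 1 else 0)"
    by (simp only: lessThan_Suc_atMost[symmetric] sum.lessThan_Suc mult_1)
  then show ?thesis by (simp only: eq_diff_eq add.commute)
qed

end

text \<open>The recursion in \<open>moment_eq\<close> sees the measure only through its lower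
  moments, so strong induction applies.\<close>

lemma moments_determined:
  assumes "circle_measure M" "circle_measure M'"
    and "\<And>j. j \<le> n \<Longrightarrow> szego_orth M a j" "\<And>j. j \<le> n \<Longrightarrow> szego_orth M' a j" "k \<le> n"
  shows "(\<integral>z. z ^ k \<partial>M) = (\<integral>z. z ^ k \<partial>M')"
  using assms(5)
proof (induction k rule: less_induct)
  case (less k)
  then have "(\<Sum>i<k. coeff (Phi a k) i * (\<integral>z. z ^ i \<partial>M)) = (\<Sum>i<k. coeff (Phi a k) i * (\<integral>z. z ^ i \<partial>M'))"
    by (intro sum.cong refl) auto
  then show ?case
    using circle_measure.moment_eq[OF assms(1) assms(3)[OF less.prems]]
      circle_measure.moment_eq[OF assms(2) assms(4)[OF less.prems]] by simp
qed

section \<open>Verblunsky coefficients of nontrivial measures\<close>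

locale nontrivial_circle_measure = circle_measure + prob_space M +
  assumes nontrivial: "\<not> finite_delta_combination M"
begin

text \<open>Otherwise p vanishes almost everywhere and the measure sits on the finitely many roots
  of p, which nontriviality excludes.\<close>

lemma integral_norm_poly_pos:
  assumes "p \<noteq> 0"
  shows "(\<integral>z. (cmod (poly p z))\<^sup>2 \<partial>M) > 0"
proof (rule ccontr)
  have int: "integrable M (\<lambda>z. (cmod (poly p z))\<^sup>2)"
    by (intro integrable_continuous continuous_intros)
  assume "\<not> ?thesis"
  moreover have "(\<integral>z. (cmod (poly p z))\<^sup>2 \<partial>M) \<ge> 0"
    by (rule Bochner_Integration.integral_nonneg) simp
  ultimately have "(\<integral>z. (cmod (poly p z))\<^sup>2 \<partial>M) = 0" by linarith
  then have ae: "AE z in M. poly p z = 0"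
    using integral_nonneg_eq_0_iff_AE[OF int] by simp
  define S where "S = {z \<in> space M. poly p z = 0}"
  have fin: "finite S" unfolding S_def using poly_roots_finite[OF assms] by simp
  have single: "{z} \<in> sets M" if "z \<in> space M" for z
    using that unfolding sets_M space_M circle_borel_def by (auto simp: sets_restrict_space intro!: image_eqI[of _ _ "{z}"])
  have "finite_delta_combination M"
    unfolding finite_delta_combination_def
  proof (intro exI conjI ballI)
    show "finite S" by (rule fin)
    show "S \<subseteq> space M" by (auto simp: S_def)
    fix A assume A: "A \<in> sets M"
    have "S \<in> sets M"
      by (rule sets.countable[OF single countable_finite[OF fin]]) (simp add: S_def)
    have "AE z in M. (z \<in> A) = (z \<in> A \<inter> S)"
      using ae AE_space by eventually_elim (simp add: S_def)
    then have "emeasure M A = emeasure M (A \<inter> S)"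
      by (rule emeasure_eq_AE) (use A \<open>S \<in> sets M\<close> in blast)+
    also have "\<dots> = (\<Sum>z\<in>A \<inter> S. emeasure M {z})"
      using fin by (intro emeasure_eq_sum_singleton single) (simp_all add: S_def)
    also have "\<dots> = (\<Sum>z\<in>S. emeasure M {z} * indicator A z)"
      by (rule sum.mono_neutral_cong_left[OF fin]) (auto simp: indicator_def)
    finally show "emeasure M A = (\<Sum>z\<in>S. emeasure M {z} * indicator A z)" .
  qed
  then show False using nontrivial by blast
qed

lemma integral_cnj_poly:
  "(\<integral>z. cnj (poly p z) * poly p z \<partial>M) = of_real (\<integral>z. (cmod (poly p z))\<^sup>2 \<partial>M)"
  unfolding integral_complex_of_real[symmetric] complex_norm_square by (simp add: mult.commute)

text \<open>The z^n terms cancel in \<open>p - q\<close>, leaving only powers to which the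
  difference is orthogonal; hence its norm is zero.\<close>

lemma monic_OP_unique:
  assumes "is_monic_OP M n p" "is_monic_OP M n q"
  shows "p = q"
proof (rule ccontr)
  assume "p \<noteq> q"
  then have ne: "p - q \<noteq> 0" by simp
  have dp: "degree p = n" "degree q = n" "coeff p n = 1" "coeff q n = 1"
    using assms by (auto simp: is_monic_OP_def)
  have "degree (p - q) \<le> n" using dp by (intro degree_diff_le) auto
  then have "(\<integral>z. cnj (poly (p - q) z) * poly (p - q) z \<partial>M) =
      (\<Sum>i\<le>n. cnj (coeff (p - q) i) * inner_L2 M (\<lambda>z. z ^ i) (poly (p - q)))"
    by (rule ip_poly)
  also have "\<dots> = 0"
  proof (intro sum.neutral ballI)
    fix i assume "i \<in> {..n}"
    then consider "i = n" | "i < n" by force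
    then show "cnj (coeff (p - q) i) * inner_L2 M (\<lambda>z. z ^ i) (poly (p - q)) = 0"
      using assms dp by cases (auto simp: ip_diff is_monic_OP_def)
  qed
  finally show False using integral_norm_poly_pos[OF ne] by (simp only: integral_cnj_poly) simp
qed

lemma monic_OP_eq: "is_monic_OP M n p \<Longrightarrow> monic_OP M n = p"
  unfolding monic_OP_def using monic_OP_unique by blast

text \<open>Links \<open>monic_OP\<close> to the recursion. One step builds a monic polynomial
  orthogonal to 1, ..., z^n; uniqueness identifies it with \<open>monic_OP\<close>, and its value at
  0 shows that the coefficient used was \<open>a n\<close>.\<close>

lemma verblunsky_szego:
  defines "a \<equiv> verblunsky M"
  shows "szego_orth M a n \<and> (\<forall>j<n. cmod (a j) < 1)"
proof (induction n)
  case 0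
  show ?case by (simp add: szego_orth_def inner_L2_def szego_norm_def prob_space)
next
  case (Suc n)
  have orth: "inner_L2 M (\<lambda>z. z ^ k) (poly (Phi a n)) = (if k = n then of_real (szego_norm a n) else 0)"
    if "k \<le> n" for k
    using Suc that by (simp add: szego_orth_def)
  have pos: "szego_norm a n > 0" using Suc by (intro szego_norm_pos) auto
  \<comment> \<open>Since 1 pairs with \<open>Psi a n\<close> to \<open>szego_norm a n\<close>, this
    multiple of \<open>Psi a n\<close> cancels the component of z Phi_n along 1; the powers z, ...,
    z^n are already orthogonal to both.\<close>
  define b where "b = cnj (inner_L2 M (\<lambda>z. z ^ 0) (poly (pCons 0 (Phi a n))) / of_real (szego_norm a n))"
  define p where "p = pCons 0 (Phi a n) - smult (cnj b) (Psi a n)"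
  \<comment> \<open>As \<open>b\<close> is not yet known to be \<open>a n\<close>, degree and
    leading coefficient are borrowed from the sequence updated at n, which has the same polynomials
    up to level n.\<close>
  have "szego_pair (a(n := b)) n = szego_pair a n" by (rule szego_pair_cong) auto
  then have p: "p = Phi (a(n := b)) (Suc n)"
    unfolding Phi_Suc by (simp add: p_def Phi_def Psi_def)
  have ipp: "inner_L2 M (\<lambda>z. z ^ k) (poly p) = 0" if k: "k < Suc n" for k
  proof (cases k)
    case 0
    have "inner_L2 M (\<lambda>z. z ^ 0) (poly (Psi a n)) = of_real (szego_norm a n)"
      using ip_Psi[of 0 n a] orth[of n] by simp
    then show ?thesis using pos unfolding 0 p_def ip_diff ip_smult by (simp add: b_def)
  next
    case (Suc l)
    then have "inner_L2 M (\<lambda>z. z ^ k) (poly (Psi a n)) = 0"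
      using ip_Psi[of k n a] orth[of "n - k"] k by simp
    then show ?thesis using orth[of l] k unfolding p_def ip_diff ip_smult Suc ip_pCons by simp
  qed
  have "is_monic_OP M (Suc n) p"
    unfolding is_monic_OP_def using ipp by (simp add: p degree_Phi lead_coeff_Phi del: lead_coeff_Phi) (metis degree_Phi lead_coeff_Phi)
  then have "monic_OP M (Suc n) = p" by (rule monic_OP_eq)
  then have ab: "a n = b"
    unfolding a_def verblunsky_def by (simp add: p_def poly_0_coeff_0)
  then have Phi: "Phi a (Suc n) = p" by (simp add: Phi_Suc p_def)
  have "of_real (1 - (cmod (a n))\<^sup>2) * inner_L2 M (\<lambda>z. z ^ Suc n) (poly (pCons 0 (Phi a n)))
     = inner_L2 M (\<lambda>z. z ^ Suc n) (poly (Phi a (Suc n)))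
       + cnj (a n) * inner_L2 M (\<lambda>z. z ^ Suc n) (poly (Psi a (Suc n)))"
    unfolding ip_smult[symmetric] ip_add[symmetric] smult_pCons_Phi ..
  moreover have "inner_L2 M (\<lambda>z. z ^ Suc n) (poly (Psi a (Suc n))) = 0"
    using ip_Psi[of "Suc n" "Suc n" a] ipp[of 0] by (simp add: Phi)
  ultimately have top: "inner_L2 M (\<lambda>z. z ^ Suc n) (poly (Phi a (Suc n))) = of_real (szego_norm a (Suc n))"
    using orth[of n] by (simp only: ip_pCons) (simp add: szego_norm_def mult.commute)
  have so: "szego_orth M a (Suc n)"
    unfolding szego_orth_def using top ipp Phi by auto
  have "(\<integral>z. cnj (poly (Phi a (Suc n)) z) * poly (Phi a (Suc n)) z \<partial>M) =
      (\<Sum>i\<le>Suc n. cnj (coeff (Phi a (Suc n)) i) * inner_L2 M (\<lambda>z. z ^ i) (poly (Phi a (Suc n))))"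
    by (rule ip_poly) (simp add: degree_Phi)
  also have "\<dots> = of_real (szego_norm a (Suc n))"
    using top ipp Phi lead_coeff_Phi[of a "Suc n"] unfolding degree_Phi by simp
  finally have "szego_norm a (Suc n) = (\<integral>z. (cmod (poly (Phi a (Suc n)) z))\<^sup>2 \<partial>M)"
    unfolding integral_cnj_poly by (metis of_real_eq_iff)
  also have "\<dots> > 0"
    using lead_coeff_Phi[of a "Suc n"] by (intro integral_norm_poly_pos) auto
  \<comment> \<open>The norm at level n + 1 is the positive norm at level n times 1 - |a n|^2, so
    its positivity bounds \<open>a n\<close>.\<close>
  finally have "(cmod (a n))\<^sup>2 < 1"
    using pos by (simp add: szego_norm_def zero_less_mult_iff)
  then have "cmod (a n) < 1" by (simp add: abs_square_less_1)
  then show ?case using so Suc less_Suc_eq by auto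
qed

lemma verblunsky_less_1: "cmod (verblunsky M n) < 1"
  using verblunsky_szego[of "Suc n"] by simp

lemma integral_norm_Phi:
  defines "a \<equiv> verblunsky M"
  shows "(\<integral>z. (cmod (poly (Phi a n) z))\<^sup>2 \<partial>M) = szego_norm a n"
proof -
  have "(\<integral>z. cnj (poly (Phi a n) z) * poly (Phi a n) z \<partial>M) =
      (\<Sum>i\<le>n. cnj (coeff (Phi a n) i) * inner_L2 M (\<lambda>z. z ^ i) (poly (Phi a n)))"
    by (rule ip_poly) (simp add: degree_Phi)
  also have "\<dots> = (\<Sum>i\<le>n. if i = n then of_real (szego_norm a n) else 0)"
    using verblunsky_szego[of n] lead_coeff_Phi[of a n]
    by (intro sum.cong refl) (auto simp: szego_orth_def degree_Phi a_def)
  finally have "complex_of_real (\<integral>z. (cmod (poly (Phi a n) z))\<^sup>2 \<partial>M) = of_real (szego_norm a n)"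
    unfolding integral_cnj_poly by simp
  then show ?thesis by (metis of_real_eq_iff)
qed

end

subsection \<open>Bernstein-Szego weights\<close>

lemma angle_measure_eq_density:
  "angle_measure = density lborel (\<lambda>x. ennreal (indicator {0..<2 * pi} x / (2 * pi)))"
proof -
  have "indicator {0..<2 * pi} x / emeasure lborel {0..<2 * pi} = ennreal (indicator {0..<2 * pi} x / (2 * pi))" for x :: real
    by (auto simp: indicator_def divide_ennreal[symmetric])
  then show ?thesis
    unfolding angle_measure_def uniform_measure_def by presburger
qed

lemma sets_angle_measure [measurable_cong, simp]: "sets angle_measure = sets borel"
  by (simp add: angle_measure_def)

lemma space_angle_measure [simp]: "space angle_measure = UNIV"
  by (simp add: angle_measure_def)

interpretation angle: prob_space angle_measure
  unfolding angle_measure_def by (rule prob_space_uniform_measure) auto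

lemma AE_angle_measure: "AE \<theta> in angle_measure. \<theta> \<in> {0..<2 * pi}"
  unfolding angle_measure_def by (rule AE_uniform_measureI) auto

lemma integral_angle_measure:
  fixes f :: "real \<Rightarrow> 'b::{banach, second_countable_topology}"
  assumes "f \<in> borel_measurable borel"
  shows "(\<integral>\<theta>. f \<theta> \<partial>angle_measure) = (1 / (2 * pi)) *\<^sub>R (LINT \<theta>:{0..<2 * pi}|lborel. f \<theta>)"
proof -
  have "(\<integral>\<theta>. f \<theta> \<partial>angle_measure) = (\<integral>\<theta>. (indicator {0..<2 * pi} \<theta> / (2 * pi)) *\<^sub>R f \<theta> \<partial>lborel)"
    unfolding angle_measure_eq_density using assms by (intro integral_density) auto
  also have "\<dots> = (\<integral>\<theta>. (1 / (2 * pi)) *\<^sub>R (indicator {0..<2 * pi} \<theta> *\<^sub>R f \<theta>) \<partial>lborel)"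
    by (intro Bochner_Integration.integral_cong refl) simp
  finally show ?thesis unfolding set_lebesgue_integral_def by (simp only: integral_scaleR_right)
qed

text \<open>Cauchy's integral formula at the centre of the unit circle; passing from [0, 2 pi] to
  the half-open interval of \<open>angle_measure\<close> drops a null point.\<close>

lemma mean_value_circle:
  assumes "f holomorphic_on ball 0 R" "R > 1"
  shows "(\<integral>\<theta>. f (cis \<theta>) \<partial>angle_measure) = f 0"
proof -
  have sub: "cball 0 1 \<subseteq> ball (0::complex) R" using assms(2) by auto
  have cont: "continuous_on (cball 0 1) f"
    using holomorphic_on_imp_continuous_on[OF assms(1)] continuous_on_subset sub by blast
  have cf: "continuous_on UNIV (\<lambda>\<theta>. f (cis \<theta>))"
    by (rule continuous_on_compose2[OF cont]) (auto intro!: continuous_intros)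
  have "f holomorphic_on ball 0 1" using assms holomorphic_on_subset sub by (meson ball_subset_cball order_trans)
  then have "((\<lambda>u. f u / (u - 0)) has_contour_integral 2 * of_real pi * \<i> * f 0) (circlepath 0 1)"
    using cont by (intro Cauchy_integral_circlepath) auto
  then have "((\<lambda>t. f (cis t) / cis t * \<i> * cis t) has_integral 2 * of_real pi * \<i> * f 0) {0..2 * pi}"
    unfolding circlepath_def by (subst (asm) has_contour_integral_part_circlepath_iff) (auto simp: mult_ac)
  then have "((\<lambda>t. f (cis t) * \<i>) has_integral 2 * of_real pi * \<i> * f 0) {0..2 * pi}"
    by (simp add: mult.commute)
  then have "((\<lambda>t. f (cis t) * \<i> * (1 / (2 * pi * \<i>))) has_integral 2 * of_real pi * \<i> * f 0 * (1 / (2 * pi * \<i>))) {0..2 * pi}"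
    by (rule has_integral_mult_left)
  then have hi: "((\<lambda>t. f (cis t) / (2 * pi)) has_integral f 0) {0..2 * pi}"
    by (simp add: field_simps)
  have "(LINT \<theta>:{0..<2 * pi}|lborel. f (cis \<theta>)) = (LINT \<theta>:{0..2 * pi}|lborel. f (cis \<theta>))"
    unfolding set_lebesgue_integral_def
  proof (rule integral_cong_AE)
    have [measurable]: "(\<lambda>\<theta>. f (cis \<theta>)) \<in> borel_measurable borel"
      by (rule borel_measurable_continuous_onI[OF cf])
    show "(\<lambda>\<theta>. indicator {0..<2 * pi} \<theta> *\<^sub>R f (cis \<theta>)) \<in> borel_measurable lborel"
      "(\<lambda>\<theta>. indicator {0..2 * pi} \<theta> *\<^sub>R f (cis \<theta>)) \<in> borel_measurable lborel" by measurable
    show "AE \<theta> in lborel. indicat_real {0..<2 * pi} \<theta> *\<^sub>R f (cis \<theta>) = indicat_real {0..2 * pi} \<theta> *\<^sub>R f (cis \<theta>)"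
      by (rule eventually_mono[OF AE_lborel_singleton[of "2 * pi"]]) (auto simp: indicator_def)
  qed
  also have "\<dots> = integral {0..2 * pi} (\<lambda>\<theta>. f (cis \<theta>))"
    by (intro set_borel_integral_eq_integral borel_integrable_compact[of "{0..2*pi}", unfolded set_integrable_def[symmetric]])
      (use cf continuous_on_subset in auto)
  also have "\<dots> = 2 * pi * f 0"
    using integral_unique[OF hi] by (simp add: field_simps)
  finally show ?thesis
    using cf by (subst integral_angle_measure) (auto intro: borel_measurable_continuous_onI simp: scaleR_conv_of_real)
qed

lemma integrable_angle_continuous:
  fixes f :: "real \<Rightarrow> 'b::{banach, second_countable_topology}"
  assumes "continuous_on UNIV f"
  shows "integrable angle_measure f"
proof -
  have "bounded (f ` {0..2 * pi})"
    by (intro compact_imp_bounded compact_continuous_image continuous_on_subset[OF assms]) auto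
  then obtain B where "\<And>z. z \<in> {0..2 * pi} \<Longrightarrow> norm (f z) \<le> B"
    unfolding bounded_iff by blast
  then have "AE \<theta> in angle_measure. norm (f \<theta>) \<le> B"
    by (intro eventually_mono[OF AE_angle_measure]) auto
  then show ?thesis using borel_measurable_continuous_onI[OF assms]
    by (intro angle.integrable_const_bound[where B=B]) auto
qed

lemma one_minus_cos_bounds: "0 \<le> 1 - cos \<theta>" "1 - cos \<theta> \<le> (2::real)"
  using cos_le_one[of \<theta>] cos_ge_minus_one[of \<theta>] by linarith+

lemma integral_one_minus_cos: "(\<integral>\<theta>. 1 - cos \<theta> \<partial>angle_measure) = 1"
proof -
  have "(\<integral>\<theta>. Re (cis \<theta>) \<partial>angle_measure) = Re (\<integral>\<theta>. cis \<theta> \<partial>angle_measure)"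
    by (intro integral_Re integrable_angle_continuous continuous_intros)
  also have "(\<integral>\<theta>. cis \<theta> \<partial>angle_measure) = 0"
    using mean_value_circle[of "\<lambda>z. z" 2] by (simp add: holomorphic_intros)
  finally have "(\<integral>\<theta>. cos \<theta> \<partial>angle_measure) = 0" by simp
  then show ?thesis
    by (subst Bochner_Integration.integral_diff)
      (auto intro!: integrable_angle_continuous continuous_intros simp: angle.prob_space[unfolded space_angle_measure])
qed

lemma integral_weight_le:
  assumes "AE \<theta> in angle_measure. g \<theta> \<ge> 0" "integrable angle_measure g"
    "integrable angle_measure (\<lambda>\<theta>. (1 - cos \<theta>) * g \<theta>)"
  shows "(\<integral>\<theta>. (1 - cos \<theta>) * g \<theta> \<partial>angle_measure) \<le> 2 * (\<integral>\<theta>. g \<theta> \<partial>angle_measure)"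
proof -
  have "AE \<theta> in angle_measure. (1 - cos \<theta>) * g \<theta> \<le> 2 * g \<theta>"
    using assms(1)
  proof eventually_elim
    case (elim \<theta>)
    have "1 - cos \<theta> \<le> 2" using cos_ge_minus_one[of \<theta>] by linarith
    then show ?case using elim by (rule mult_right_mono)
  qed
  then have "(\<integral>\<theta>. (1 - cos \<theta>) * g \<theta> \<partial>angle_measure) \<le> (\<integral>\<theta>. 2 * g \<theta> \<partial>angle_measure)"
    using assms by (intro integral_mono_AE) auto
  then show ?thesis by simp
qed

lemma integrable_log_bounded:
  fixes h :: "real \<Rightarrow> real"
  assumes [measurable]: "h \<in> borel_measurable borel" and m: "0 < m" and h: "\<And>\<theta>. m \<le> h \<theta>" "\<And>\<theta>. h \<theta> \<le> B"
  shows "integrable angle_measure (\<lambda>\<theta>. (1 - cos \<theta>) * ln (h \<theta>))"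
proof (rule angle.integrable_const_bound[where B="2 * (\<bar>ln m\<bar> + \<bar>ln B\<bar>)"])
  have "\<bar>1 - cos \<theta>\<bar> * \<bar>ln (h \<theta>)\<bar> \<le> 2 * (\<bar>ln m\<bar> + \<bar>ln B\<bar>)" for \<theta>
  proof (rule mult_mono)
    show "\<bar>1 - cos \<theta>\<bar> \<le> 2" using cos_ge_minus_one[of \<theta>] cos_le_one[of \<theta>] by linarith
    have hp: "0 < h \<theta>" using m h(1)[of \<theta>] by linarith
    have "ln m \<le> ln (h \<theta>)" by (rule ln_mono[OF h(1) m])
    moreover have "ln (h \<theta>) \<le> ln B" by (rule ln_mono[OF h(2) hp])
    ultimately show "\<bar>ln (h \<theta>)\<bar> \<le> \<bar>ln m\<bar> + \<bar>ln B\<bar>" by linarith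
  qed auto
  then show "AE \<theta> in angle_measure. norm ((1 - cos \<theta>) * ln (h \<theta>)) \<le> 2 * (\<bar>ln m\<bar> + \<bar>ln B\<bar>)"
    by (simp add: abs_mult)
qed measurable

lemma measurable_cis_circle [measurable]: "cis \<in> measurable borel circle_borel"
  unfolding circle_borel_def
  by (intro measurable_restrict_space2 borel_measurable_continuous_onI) (auto intro!: continuous_intros)

lemma nn_integral_circle_ac:
  assumes [measurable]: "w \<in> borel_measurable borel" "f \<in> borel_measurable circle_borel"
  shows "(\<integral>\<^sup>+z. f z \<partial>circle_ac w) = (\<integral>\<^sup>+\<theta>. ennreal (w \<theta>) * f (cis \<theta>) \<partial>angle_measure)"
  unfolding circle_ac_def
  by (subst nn_integral_distr, simp, simp, subst nn_integral_density) auto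

lemma integral_circle_ac:
  fixes f :: "complex \<Rightarrow> 'b::{banach, second_countable_topology}"
  assumes [measurable]: "w \<in> borel_measurable borel" "f \<in> borel_measurable circle_borel"
    and "\<And>\<theta>. \<theta> \<in> {0..<2 * pi} \<Longrightarrow> 0 \<le> w \<theta>"
  shows "(\<integral>z. f z \<partial>circle_ac w) = (\<integral>\<theta>. w \<theta> *\<^sub>R f (cis \<theta>) \<partial>angle_measure)"
proof -
  have "AE \<theta> in angle_measure. 0 \<le> w \<theta>"
    by (rule eventually_mono[OF AE_angle_measure]) (rule assms(3))
  then show ?thesis unfolding circle_ac_def
    by (subst integral_distr, simp, simp, subst integral_density) auto
qed

lemma sets_circle_ac [simp]: "sets (circle_ac w) = sets circle_borel"
  by (simp add: circle_ac_def)

lemma circle_measure_circle_ac: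
  assumes "continuous_on UNIV w"
  shows "circle_measure (circle_ac w)"
proof -
  have [measurable]: "w \<in> borel_measurable borel" by (rule borel_measurable_continuous_onI[OF assms])
  have "emeasure (circle_ac w) (space (circle_ac w)) = (\<integral>\<^sup>+z. 1 \<partial>circle_ac w)" by simp
  also have "\<dots> = (\<integral>\<^sup>+\<theta>. ennreal (w \<theta>) \<partial>angle_measure)"
    by (subst nn_integral_circle_ac) auto
  also have "\<dots> < \<infinity>"
    using integrable_angle_continuous[OF assms] integrable_iff_bounded
    by (metis integrableD(2) top.not_eq_extremum infinity_ennreal_def integrable_def nn_integral_mono)
  finally show ?thesis by (intro circle_measure.intro circle_measure_axioms.intro finite_measureI) auto
qed

section \<open>Logarithmic integral and orthogonality of the Bernstein-Szego weights\<close>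

definition bs_weight :: "(nat \<Rightarrow> complex) \<Rightarrow> nat \<Rightarrow> real \<Rightarrow> real" where
  "bs_weight a n \<theta> = szego_norm a n / (cmod (poly (Phi a n) (cis \<theta>)))\<^sup>2"

text \<open>Finitely many zeros, all outside the closed disk, leave a larger zero-free disk, which
  is convex and so carries a logarithm. Its value at 0 can be subtracted because
  \<open>poly (Psi a n) 0 = 1\<close>.\<close>

lemma log_Psi_exists:
  assumes a: "\<And>j. cmod (a j) < 1"
  obtains R F where "R > 1" "F holomorphic_on ball 0 R" "F 0 = 0"
    "\<And>z. z \<in> ball 0 R \<Longrightarrow> exp (F z) = poly (Psi a n) z"
proof -
  let ?S = "{z. poly (Psi a n) z = 0}"
  have nz: "poly (Psi a n) z \<noteq> 0" if "cmod z \<le> 1" for z using Psi_nonzero[of a z n, OF a that] .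
  obtain R where R: "R > 1" "\<And>z. z \<in> ball 0 R \<Longrightarrow> poly (Psi a n) z \<noteq> 0"
  proof -
    have "finite ?S" using nz[of 0] by (intro poly_roots_finite) auto
    then have f: "finite (insert 2 (cmod ` ?S))" by simp
    \<comment> \<open>The element 2 keeps the set nonempty when \<open>Psi a n\<close> has no
      zeros.\<close>
    define R where "R = Min (insert 2 (cmod ` ?S))"
    have "R > 1" unfolding R_def using f nz by (subst Min_gr_iff) (auto simp: not_le[symmetric])
    moreover have "poly (Psi a n) z \<noteq> 0" if "z \<in> ball 0 R" for z
    proof
      assume "poly (Psi a n) z = 0"
      then have "R \<le> cmod z" unfolding R_def using f by (intro Min_le) auto
      then show False using that by simp
    qed
    ultimately show ?thesis using that by blast
  qed
  have h: "poly (Psi a n) holomorphic_on ball 0 R" by (intro holomorphic_intros)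
  have z: "0 \<in> ball (0::complex) R" using R(1) by simp
  obtain g where g: "g holomorphic_on ball 0 R" "\<And>z. z \<in> ball 0 R \<Longrightarrow> exp (g z) = poly (Psi a n) z"
    by (rule holomorphic_logarithm_exists[OF convex_ball open_ball h R(2) z]) blast+
  have "poly (Psi a n) 0 = 1" by (simp add: poly_0_coeff_0)
  then have "exp (g 0) = 1" using g(2)[of 0] R(1) by simp
  then have g': "exp (g z - g 0) = poly (Psi a n) z" if "z \<in> ball 0 R" for z
    using g(2)[OF that] by (simp add: exp_diff)
  have "(\<lambda>z. g z - g 0) holomorphic_on ball 0 R" by (intro holomorphic_intros g(1))
  then show ?thesis using that[of R "\<lambda>z. g z - g 0"] R(1) g' by simp
qed

text \<open>On the circle log |Phi_n|^2 = 2 Re F with F the logarithm of Psi_n, and 2 (1 - cos) F =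
  (2 - z - 1/z) F. With the removable singularity of F / z filled in as \<open>G\<close> this is
  holomorphic, and its value at 0 is -F'(0), where F'(0) is the linear coefficient of Psi_n.\<close>

lemma integral_log_Phi:
  assumes a: "\<And>j. cmod (a j) < 1"
  shows "(\<integral>\<theta>. (1 - cos \<theta>) * ln ((cmod (poly (Phi a n) (cis \<theta>)))\<^sup>2) \<partial>angle_measure) = - Re (coeff (Psi a n) 1)"
proof -
  obtain R F where R: "R > 1" and F: "F holomorphic_on ball 0 R" "F 0 = 0"
    and expF: "\<And>z. z \<in> ball 0 R \<Longrightarrow> exp (F z) = poly (Psi a n) z"
    using log_Psi_exists[of a n, OF a] by blast
  define G where "G z = (if z = 0 then deriv F 0 else (F z - F 0) / (z - 0))" for z
  have G: "G holomorphic_on ball 0 R"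
    unfolding G_def by (rule pole_lemma_open[OF F(1) open_ball])
  have zB: "0 \<in> ball 0 R" "cis \<theta> \<in> ball 0 R" for \<theta> using R by auto
  have "(F has_field_derivative deriv F 0) (at 0)"
    using F(1) zB holomorphic_derivI open_ball by blast
  then have "((\<lambda>z. exp (F z)) has_field_derivative exp (F 0) * deriv F 0) (at 0)"
    by (auto intro!: derivative_eq_intros)
  then have "(poly (Psi a n) has_field_derivative deriv F 0) (at 0)"
    using F(2) by (auto intro: has_field_derivative_transform_within_open[OF _ open_ball zB(1)] simp: expF)
  moreover have "(poly (Psi a n) has_field_derivative poly (pderiv (Psi a n)) 0) (at 0)" by (rule poly_DERIV)
  ultimately have dF: "deriv F 0 = coeff (Psi a n) 1"
    using DERIV_unique by (fastforce simp: poly_0_coeff_0 coeff_pderiv)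
  have cont: "continuous_on UNIV (\<lambda>\<theta>. H (cis \<theta>))" if "H holomorphic_on ball 0 R" for H
    by (rule continuous_on_compose2[OF holomorphic_on_imp_continuous_on[OF that]])
      (use R in \<open>auto intro!: continuous_intros\<close>)
  have zF: "(\<lambda>z. z * F z) holomorphic_on ball 0 R" by (intro holomorphic_intros F)
  let ?K = "\<lambda>z. 2 * F z - z * F z - G z"
  have K: "?K holomorphic_on ball 0 R" by (intro holomorphic_intros F G)
  have pt: "(1 - cos \<theta>) * ln ((cmod (poly (Phi a n) (cis \<theta>)))\<^sup>2) = Re (?K (cis \<theta>))" for \<theta>
  proof -
    have "cmod (poly (Phi a n) (cis \<theta>)) = exp (Re (F (cis \<theta>)))"
      using expF[OF zB(2)[of \<theta>]] cmod_Psi_eq_Phi[of "cis \<theta>" a n] norm_exp_eq_Re by (metis norm_cis)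
    then have "ln ((cmod (poly (Phi a n) (cis \<theta>)))\<^sup>2) = 2 * Re (F (cis \<theta>))"
      by (simp add: ln_realpow)
    moreover have "G (cis \<theta>) = cis (- \<theta>) * F (cis \<theta>)"
      by (simp add: G_def F(2) divide_inverse mult.commute)
    ultimately show ?thesis by (simp add: algebra_simps)
  qed
  have "(\<integral>\<theta>. ?K (cis \<theta>) \<partial>angle_measure) = ?K 0"
    by (rule mean_value_circle[OF K R])
  moreover have "(\<integral>\<theta>. Re (?K (cis \<theta>)) \<partial>angle_measure) = Re (\<integral>\<theta>. ?K (cis \<theta>) \<partial>angle_measure)"
    by (intro integral_Re integrable_angle_continuous cont[OF K])
  ultimately show ?thesis unfolding pt by (simp add: F(2) G_def dF)
qed

context
  fixes a :: "nat \<Rightarrow> complex"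
  assumes a: "\<And>j. cmod (a j) < 1"
begin

lemma bs_weight_pos: "bs_weight a n \<theta> > 0"
  unfolding bs_weight_def using Phi_nonzero_circle[of a "cis \<theta>" n, OF a] szego_norm_pos[of n a] a by simp

lemma continuous_bs_weight: "continuous_on S (bs_weight a n)"
  unfolding bs_weight_def using Phi_nonzero_circle[of a _ n, OF a]
  by (intro continuous_intros) auto

lemma integral_log_bs_weight:
  "(\<integral>\<theta>. (1 - cos \<theta>) * ln (bs_weight a n \<theta>) \<partial>angle_measure) = ln (szego_norm a n) + Re (coeff (Psi a n) 1)"
proof -
  have cln: "continuous_on UNIV (\<lambda>\<theta>. (1 - cos \<theta>) * ln ((cmod (poly (Phi a n) (cis \<theta>)))\<^sup>2))"
    using Phi_nonzero_circle[of a _ n, OF a] by (intro continuous_intros) auto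
  have one: "(\<integral>\<theta>. (1 - cos \<theta>) * c \<partial>angle_measure) = c" for c
    using integral_one_minus_cos by (subst integral_mult_left_zero) simp
  have "(1 - cos \<theta>) * ln (bs_weight a n \<theta>) =
     (1 - cos \<theta>) * ln (szego_norm a n) - (1 - cos \<theta>) * ln ((cmod (poly (Phi a n) (cis \<theta>)))\<^sup>2)" for \<theta>
    unfolding bs_weight_def using Phi_nonzero_circle[of a "cis \<theta>" n, OF a] szego_norm_pos[of n a] a
    by (subst ln_div) (auto simp: algebra_simps)
  then have "(\<integral>\<theta>. (1 - cos \<theta>) * ln (bs_weight a n \<theta>) \<partial>angle_measure) =
    (\<integral>\<theta>. (1 - cos \<theta>) * ln (szego_norm a n) - (1 - cos \<theta>) * ln ((cmod (poly (Phi a n) (cis \<theta>)))\<^sup>2) \<partial>angle_measure)"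
    by presburger
  also have "\<dots> = ln (szego_norm a n) - (\<integral>\<theta>. (1 - cos \<theta>) * ln ((cmod (poly (Phi a n) (cis \<theta>)))\<^sup>2) \<partial>angle_measure)"
    using one by (subst Bochner_Integration.integral_diff)
      (auto intro!: integrable_angle_continuous continuous_intros cln)
  finally show ?thesis using integral_log_Phi[of a n, OF a] by simp
qed

text \<open>Writing |Phi_n|^2 as Phi_n times its conjugate reduces the integrand on the circle to
  \<open>szego_norm a n\<close> times z^(n-k) / Psi_n, holomorphic on a larger disk. Its value at 0
  vanishes for k < n and is the norm for k = n.\<close>

lemma szego_orth_bs_weight: "szego_orth (circle_ac (bs_weight a n)) a n"
  unfolding szego_orth_def
proof (intro allI impI)
  fix k assume k: "k \<le> n"
  obtain R F where R: "R > 1" and F: "F holomorphic_on ball 0 R" "F 0 = 0"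
    and expF: "\<And>z. z \<in> ball 0 R \<Longrightarrow> exp (F z) = poly (Psi a n) z"
    using log_Psi_exists[of a n, OF a] by blast
  define f where "f z = szego_norm a n * z ^ (n - k) / exp (F z)" for z :: complex
  have f: "f holomorphic_on ball 0 R" unfolding f_def by (intro holomorphic_intros F) auto
  have pt: "bs_weight a n \<theta> *\<^sub>R (cnj (cis \<theta> ^ k) * poly (Phi a n) (cis \<theta>)) = f (cis \<theta>)" for \<theta>
  proof -
    let ?z = "cis \<theta>"
    let ?p = "poly (Phi a n) ?z"
    have zz: "?z ^ k * cnj ?z ^ k = 1"
      by (simp add: power_mult_distrib[symmetric] complex_norm_square[symmetric])
    have "?z ^ n = ?z ^ (n - k) * ?z ^ k" using k by (simp add: power_add[symmetric])
    then have "?z ^ (n - k) = ?z ^ n * cnj ?z ^ k" using zz by (simp add: mult.assoc)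
    moreover have "exp (F ?z) = ?z ^ n * cnj ?p" using expF[of ?z] R poly_Psi_eq_reflection[of ?z a n] by simp
    moreover have "complex_of_real ((cmod ?p)\<^sup>2) = ?p * cnj ?p" by (rule complex_norm_square)
    moreover have "?p \<noteq> 0" using Phi_nonzero_circle[of a ?z n, OF a] by simp
    ultimately show ?thesis
      unfolding f_def bs_weight_def scaleR_conv_of_real of_real_divide by (simp add: field_simps)
  qed
  have m: "(\<lambda>z. cnj (z ^ k) * poly (Phi a n) z) \<in> borel_measurable circle_borel"
    unfolding circle_borel_def by (intro borel_measurable_continuous_on_restrict continuous_intros)
  have "inner_L2 (circle_ac (bs_weight a n)) (\<lambda>z. z ^ k) (poly (Phi a n)) = (\<integral>\<theta>. f (cis \<theta>) \<partial>angle_measure)"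
    unfolding inner_L2_def pt[symmetric]
    using m bs_weight_pos borel_measurable_continuous_onI[OF continuous_bs_weight]
    by (intro integral_circle_ac) (auto intro: less_imp_le)
  also have "\<dots> = f 0" by (rule mean_value_circle[OF f R])
  finally show "inner_L2 (circle_ac (bs_weight a n)) (\<lambda>z. z ^ k) (poly (Phi a n)) = (if k = n then of_real (szego_norm a n) else 0)"
    using k by (auto simp: f_def F(2))
qed

end

subsection \<open>Density of continuous functions and trigonometric polynomials\<close>

text \<open>Lets a single L^1 approximation be good for \<open>M\<close> and for arc length at
  once.\<close>

definition add_measure :: "'a measure \<Rightarrow> 'a measure \<Rightarrow> 'a measure" where
  "add_measure M N = measure_of (space M) (sets M) (\<lambda>A. emeasure M A + emeasure N A)"

lemma sets_add_measure [simp]: "sets (add_measure M N) = sets M"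
  by (simp add: add_measure_def)

lemma space_add_measure [simp]: "space (add_measure M N) = space M"
  by (simp add: add_measure_def)

lemma emeasure_add_measure:
  assumes "sets N = sets M" "A \<in> sets M"
  shows "emeasure (add_measure M N) A = emeasure M A + emeasure N A"
  unfolding add_measure_def
proof (rule emeasure_measure_of_sigma)
  show "countably_additive (sets M) (\<lambda>A. emeasure M A + emeasure N A)"
    using assms(1) by (intro countably_additiveI) (simp add: suminf_add[symmetric] suminf_emeasure image_subset_iff)
qed (use assms in \<open>auto simp: positive_def intro: sets.sigma_algebra_axioms\<close>)

text \<open>Formulated through additivity on sets so that it covers both \<open>add_measure\<close>
  and a Lebesgue decomposition.\<close>

lemma nn_integral_emeasure_add:
  assumes sets: "sets M1 = sets M" "sets M2 = sets M"
    and em: "\<And>A. A \<in> sets M \<Longrightarrow> emeasure M A = emeasure M1 A + emeasure M2 A"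
    and f: "f \<in> borel_measurable M"
  shows "(\<integral>\<^sup>+x. f x \<partial>M) = (\<integral>\<^sup>+x. f x \<partial>M1) + (\<integral>\<^sup>+x. f x \<partial>M2)"
proof -
  have meas: "g \<in> borel_measurable M1" "g \<in> borel_measurable M2" if "g \<in> borel_measurable M" for g :: "'a \<Rightarrow> ennreal"
    using that measurable_cong_sets[OF sets(1) refl] measurable_cong_sets[OF sets(2) refl] by auto
  show ?thesis using f
  proof (induction rule: borel_measurable_induct)
    case (cong f g)
    have "space M1 = space M" "space M2 = space M" using sets by (auto dest: sets_eq_imp_space_eq)
    then have "integral\<^sup>N M f = integral\<^sup>N M g" "integral\<^sup>N M1 f = integral\<^sup>N M1 g"
      "integral\<^sup>N M2 f = integral\<^sup>N M2 g"
      using cong.hyps(3) by (auto intro!: nn_integral_cong)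
    then show ?case using cong.IH by simp
  next
    case (set A)
    then show ?case using sets em by simp
  next
    case (mult u c)
    then show ?case using meas[OF mult.hyps(2)] by (simp add: nn_integral_cmult distrib_left)
  next
    case (add u v)
    then show ?case using meas[OF add.hyps(1)] meas[OF add.hyps(3)] by (simp add: nn_integral_add add_ac)
  next
    case (seq U)
    have U: "U i \<in> borel_measurable M1" "U i \<in> borel_measurable M2" for i
      using meas[OF seq.hyps(1)[of i]] by auto
    have mono: "incseq (\<lambda>i. integral\<^sup>N N (U i))" for N
      using seq.hyps by (auto simp: incseq_def le_fun_def intro!: nn_integral_mono)
    show ?case
      unfolding SUP_apply image_comp o_def
      using seq U by (subst (1 2 3) nn_integral_monotone_convergence_SUP)
        (auto simp: ennreal_SUP_add[OF mono mono])
  qed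
qed

text \<open>For an indicator, regularity squeezes A between a compact K and an open U, and Urysohn's
  lemma gives a continuous function differing from it only on U - K. Sums and dominated limits do
  the rest.\<close>

lemma continuous_dense_L1:
  fixes f :: "'a::euclidean_space \<Rightarrow> real"
  assumes fin: "finite_measure M" and sets: "sets M = sets borel" and f: "integrable M f" and e: "e > 0"
  shows "\<exists>g. continuous_on UNIV g \<and> integrable M g \<and> (\<integral>x. \<bar>f x - g x\<bar> \<partial>M) < e"
  using f e
proof (induction arbitrary: e rule: integrable_induct)
  case (base A c)
  interpret finite_measure M by (rule fin)
  have A: "A \<in> sets borel" using base sets by simp
  \<comment> \<open>\<open>U - K\<close> will have mass at most \<open>2 * d\<close>, so the error
    stays below \<open>e\<close>; the \<open>+ 1\<close> covers \<open>c = 0\<close>.\<close>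
  define d where "d = e / (2 * (\<bar>c\<bar> + 1))"
  have d: "d > 0" using base by (simp add: d_def)
  have Afin: "emeasure M A \<noteq> \<infinity>" "emeasure M (space M) \<noteq> \<infinity>" by auto
  have "\<exists>K. K \<subseteq> A \<and> compact K \<and> measure M A - d < measure M K"
  proof -
    \<comment> \<open>A negative \<open>measure M A - d\<close> is collapsed to 0 by
      \<open>ennreal\<close>, so that case is split off and served by the empty set.\<close>
    have "ennreal (measure M A - d) < emeasure M A \<or> measure M A - d < 0"
      using d by (auto simp: emeasure_eq_measure intro!: ennreal_lessI)
    then show ?thesis
    proof
      assume "ennreal (measure M A - d) < emeasure M A"
      then obtain K where "K \<subseteq> A" "compact K" "ennreal (measure M A - d) < emeasure M K"
        unfolding inner_regular[OF sets Afin(2) A] less_SUP_iff by auto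
      then show ?thesis by (auto simp: emeasure_eq_measure ennreal_less_iff intro!: exI[of _ K])
         (metis ennreal_less_iff ennreal_neg linorder_not_le measure_nonneg order_less_le_trans)
    next
      assume "measure M A - d < 0"
      then show ?thesis by (intro exI[of _ "{}"]) auto
    qed
  qed
  then obtain K where K: "K \<subseteq> A" "compact K" "measure M A - d < measure M K" by blast
  have "\<exists>U. A \<subseteq> U \<and> open U \<and> measure M U < measure M A + d"
  proof -
    have "emeasure M A < ennreal (measure M A + d)"
      using d by (auto simp: emeasure_eq_measure intro!: ennreal_lessI add_nonneg_pos)
    then obtain U where "A \<subseteq> U" "open U" "emeasure M U < ennreal (measure M A + d)"
      by (subst (asm) outer_regular[OF sets Afin(2) A]) (auto simp: INF_less_iff)
    moreover from this(3) have "measure M U < measure M A + d"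
      by (simp only: emeasure_eq_measure ennreal_less_iff[OF measure_nonneg])
    ultimately show ?thesis by blast
  qed
  then obtain U where U: "A \<subseteq> U" "open U" "measure M U < measure M A + d" by blast
  have sK: "K \<in> sets M" and sU: "U \<in> sets M" and sA: "A \<in> sets M"
    using borel_closed[OF compact_imp_closed[OF K(2)]] borel_open[OF U(2)] A sets by auto
  have "closed K" "closed (- U)" "K \<inter> - U = {}" using K U compact_imp_closed by auto
  then obtain g :: "'a \<Rightarrow> real" where g: "continuous_on UNIV g" "\<And>x. g x \<in> closed_segment 1 0"
    "\<And>x. x \<in> K \<Longrightarrow> g x = 1" "\<And>x. x \<in> - U \<Longrightarrow> g x = 0"
    by (rule Urysohn[where a = 1 and b = 0]) blast
  have g01: "0 \<le> g x" "g x \<le> 1" for x using g(2)[of x] by (auto simp: closed_segment_eq_real_ivl)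
  have gm: "g \<in> borel_measurable M"
    using borel_measurable_continuous_onI[OF g(1)] measurable_cong_sets[OF sets refl] by auto
  then have gi: "integrable M g" using g01 by (intro integrable_const_bound[where B=1]) auto
  have ai: "integrable M (indicat_real A)" using sA by (auto simp: less_top[symmetric])
  have le: "\<bar>indicat_real A x *\<^sub>R c - g x * c\<bar> \<le> \<bar>c\<bar> * indicat_real (U - K) x" for x
  proof -
    have "\<bar>indicat_real A x - g x\<bar> \<le> indicat_real (U - K) x"
      using g01[of x] g(3,4)[of x] K(1) U(1) by (auto simp: indicator_def)
    then have "\<bar>c\<bar> * \<bar>indicat_real A x - g x\<bar> \<le> \<bar>c\<bar> * indicat_real (U - K) x" by (intro mult_left_mono) auto
    then show ?thesis by (simp add: abs_mult[symmetric] algebra_simps)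
  qed
  have "(\<integral>x. \<bar>indicat_real A x *\<^sub>R c - g x * c\<bar> \<partial>M) \<le> (\<integral>x. \<bar>c\<bar> * indicat_real (U - K) x \<partial>M)"
    using le sU sK ai gi by (intro integral_mono) (auto simp: less_top[symmetric])
  also have "\<dots> = \<bar>c\<bar> * measure M (U - K)" using sU sK by simp
  also have "\<dots> = \<bar>c\<bar> * (measure M U - measure M K)"
    using sU sK K(1) U(1) by (subst finite_measure_Diff) auto
  also have "\<dots> \<le> \<bar>c\<bar> * (2 * d)" using K U by (intro mult_left_mono) auto
  also have "\<dots> < e" using base(3) by (simp add: d_def field_simps)
  finally show ?case using g(1) gi by (intro exI[of _ "\<lambda>x. g x * c"]) (auto intro!: continuous_intros)
next
  case (add f g)
  obtain f' where f': "continuous_on UNIV f'" "integrable M f'" "(\<integral>x. \<bar>f x - f' x\<bar> \<partial>M) < e / 2"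
    using add.IH(1)[of "e / 2"] add.prems by auto
  obtain g' where g': "continuous_on UNIV g'" "integrable M g'" "(\<integral>x. \<bar>g x - g' x\<bar> \<partial>M) < e / 2"
    using add.IH(2)[of "e / 2"] add.prems by auto
  have "(\<integral>x. \<bar>f x + g x - (f' x + g' x)\<bar> \<partial>M) \<le> (\<integral>x. \<bar>f x - f' x\<bar> + \<bar>g x - g' x\<bar> \<partial>M)"
    using add.hyps f' g' by (intro integral_mono) auto
  also have "\<dots> = (\<integral>x. \<bar>f x - f' x\<bar> \<partial>M) + (\<integral>x. \<bar>g x - g' x\<bar> \<partial>M)"
    using add.hyps f' g' by (intro Bochner_Integration.integral_add) auto
  also have "\<dots> < e" using f'(3) g'(3) by simp
  finally show ?case using f' g' by (intro exI[of _ "\<lambda>x. f' x + g' x"]) (auto intro!: continuous_intros)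
next
  case (lim f s)
  have "(\<lambda>i. \<integral>x. \<bar>f x - s i x\<bar> \<partial>M) \<longlonglongrightarrow> (\<integral>x. 0 \<partial>M)"
  \<comment> \<open>The induction rule bounds the approximants by twice |f|, hence the difference by
    three times |f|.\<close>
  proof (rule integral_dominated_convergence[where w="\<lambda>x. 3 * \<bar>f x\<bar>"])
    show "AE x in M. (\<lambda>i. \<bar>f x - s i x\<bar>) \<longlonglongrightarrow> 0"
    proof (rule AE_I2)
      fix x assume "x \<in> space M"
      then have "(\<lambda>i. \<bar>f x - s i x\<bar>) \<longlonglongrightarrow> \<bar>f x - f x\<bar>" by (intro tendsto_intros lim.hyps(2))
      then show "(\<lambda>i. \<bar>f x - s i x\<bar>) \<longlonglongrightarrow> 0" by simp
    qed
    show "AE x in M. norm \<bar>f x - s i x\<bar> \<le> 3 * \<bar>f x\<bar>" for i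
    proof (rule AE_I2)
      fix x assume "x \<in> space M"
      then show "norm \<bar>f x - s i x\<bar> \<le> 3 * \<bar>f x\<bar>" using lim.hyps(3)[of x i] by auto
    qed
  qed (use lim.hyps in auto)
  then have "(\<lambda>i. \<integral>x. \<bar>f x - s i x\<bar> \<partial>M) \<longlonglongrightarrow> 0" by simp
  then have "\<forall>\<^sub>F i in sequentially. (\<integral>x. \<bar>f x - s i x\<bar> \<partial>M) < e / 2"
    using lim.prems by (intro order_tendstoD) auto
  then obtain i where i: "(\<integral>x. \<bar>f x - s i x\<bar> \<partial>M) < e / 2" by (auto simp: eventually_sequentially)
  obtain g where g: "continuous_on UNIV g" "integrable M g" "(\<integral>x. \<bar>s i x - g x\<bar> \<partial>M) < e / 2"
    using lim.IH[of "e / 2" i] lim.prems by auto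
  have "(\<integral>x. \<bar>f x - g x\<bar> \<partial>M) \<le> (\<integral>x. \<bar>f x - s i x\<bar> + \<bar>s i x - g x\<bar> \<partial>M)"
    using lim.hyps g by (intro integral_mono) auto
  also have "\<dots> = (\<integral>x. \<bar>f x - s i x\<bar> \<partial>M) + (\<integral>x. \<bar>s i x - g x\<bar> \<partial>M)"
    using lim.hyps g by (intro Bochner_Integration.integral_add) auto
  also have "\<dots> < e" using g(3) i by simp
  finally show ?case using g by blast
qed

text \<open>Laurent polynomials on the circle: a power of z clears the denominators, and since cnj z
  = 1 / z there, real polynomials in Re z and Im z qualify.\<close>

definition trig_poly :: "(complex \<Rightarrow> complex) \<Rightarrow> bool" where
  "trig_poly f \<longleftrightarrow> (\<exists>N p. \<forall>z. cmod z = 1 \<longrightarrow> f z * z ^ N = poly p z)"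

lemma trig_poly_const: "trig_poly (\<lambda>_. c)"
  unfolding trig_poly_def by (intro exI[of _ 0] exI[of _ "[:c:]"]) simp

lemma trig_poly_add:
  assumes "trig_poly f" "trig_poly g"
  shows "trig_poly (\<lambda>z. f z + g z)"
proof -
  obtain N p N' q where "\<And>z. cmod z = 1 \<Longrightarrow> f z * z ^ N = poly p z" "\<And>z. cmod z = 1 \<Longrightarrow> g z * z ^ N' = poly q z"
    using assms unfolding trig_poly_def by blast
  then have "(f z + g z) * z ^ (N + N') = poly (monom 1 N' * p + monom 1 N * q) z" if "cmod z = 1" for z
    using that by (simp add: poly_monom power_add algebra_simps flip: \<open>\<And>z. cmod z = 1 \<Longrightarrow> f z * z ^ N = poly p z\<close>)
  then show ?thesis unfolding trig_poly_def by blast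
qed

lemma trig_poly_mult:
  assumes "trig_poly f" "trig_poly g"
  shows "trig_poly (\<lambda>z. f z * g z)"
proof -
  obtain N p N' q where *: "\<And>z. cmod z = 1 \<Longrightarrow> f z * z ^ N = poly p z" "\<And>z. cmod z = 1 \<Longrightarrow> g z * z ^ N' = poly q z"
    using assms unfolding trig_poly_def by blast
  have "f z * g z * z ^ (N + N') = poly (p * q) z" if "cmod z = 1" for z
    unfolding poly_mult *(1)[OF that, symmetric] *(2)[OF that, symmetric] by (simp add: power_add)
  then show ?thesis unfolding trig_poly_def by blast
qed

lemma trig_poly_Re_Im: "trig_poly (\<lambda>z. of_real (Re z))" "trig_poly (\<lambda>z. of_real (Im z))"
proof -
  have *: "z * cnj z = 1" if "cmod z = 1" for z using that by (simp add: complex_norm_square[symmetric])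
  have re: "of_real (Re z) * z ^ 1 = poly [:1/2, 0, 1/2:] z" if "cmod z = 1" for z
  proof -
    have "complex_of_real (Re z) = (z + cnj z) / 2" by (simp add: complex_eq_iff)
    then have "of_real (Re z) * z = (z * z + z * cnj z) / 2" by (simp add: algebra_simps)
    then show ?thesis unfolding *[OF that] by (simp add: algebra_simps add_divide_distrib)
  qed
  have im: "of_real (Im z) * z ^ 1 = poly [:\<i>/2, 0, -\<i>/2:] z" if "cmod z = 1" for z
  proof -
    have "complex_of_real (Im z) = (cnj z - z) * \<i> / 2" by (simp add: complex_eq_iff)
    then have "of_real (Im z) * z = (cnj z - z) * \<i> / 2 * z" by (simp only:)
    also have "\<dots> = (z * cnj z - z * z) * \<i> / 2" by (simp add: algebra_simps)
    finally have "of_real (Im z) * z = (z * cnj z - z * z) * \<i> / 2" .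
    then show ?thesis unfolding *[OF that] by (simp add: algebra_simps diff_divide_distrib)
  qed
  show "trig_poly (\<lambda>z. of_real (Re z))" unfolding trig_poly_def using re by blast
  show "trig_poly (\<lambda>z. of_real (Im z))" unfolding trig_poly_def using im by blast
qed

lemma real_polynomial_function_trig_poly:
  assumes "real_polynomial_function g"
  shows "trig_poly (\<lambda>z. of_real (g z))"
  using assms
proof induction
  case (linear f)
  interpret bounded_linear f by (rule linear)
  have "f z = Re z * f 1 + Im z * f \<i>" for z
  proof -
    have "z = Re z *\<^sub>R 1 + Im z *\<^sub>R \<i>" by (simp add: complex_eq_iff)
    then have "f z = f (Re z *\<^sub>R 1 + Im z *\<^sub>R \<i>)" by (rule arg_cong)
    also have "\<dots> = Re z * f 1 + Im z * f \<i>" by (simp only: add scaleR real_scaleR_def)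
    finally show ?thesis .
  qed
  then have "(\<lambda>z. complex_of_real (f z)) = (\<lambda>z. of_real (Re z) * of_real (f 1) + of_real (Im z) * of_real (f \<i>))"
    by (metis of_real_add of_real_mult)
  then show ?case
    by (simp only:) (intro trig_poly_add trig_poly_mult trig_poly_const trig_poly_Re_Im)
qed (simp_all add: trig_poly_add trig_poly_mult trig_poly_const)

text \<open>Multiplying by \<open>cnj z ^ N\<close> shows that on the circle f is a combination of
  z^j and (cnj z)^j with j <= n; moments of conjugate powers are conjugates of those matched by
  \<open>mom\<close>.\<close>

lemma integral_trig_poly_eq:
  assumes M: "circle_measure M" "circle_measure M'"
    and mom: "\<And>k. k \<le> n \<Longrightarrow> (\<integral>z. z ^ k \<partial>M) = (\<integral>z. z ^ k \<partial>M')"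
    and f: "\<And>z. cmod z = 1 \<Longrightarrow> f z * z ^ N = poly p z" and n: "N \<le> n" "degree p \<le> n"
  shows "(\<integral>z. f z \<partial>M) = (\<integral>z. f z \<partial>M')"
proof -
  define m where "m i z = (if N \<le> i then z ^ (i - N) else cnj (z ^ (N - i)))" for i z
  have m: "z ^ i * cnj z ^ N = m i z" if "cmod z = 1" for i z
  proof -
    have "z * cnj z = 1" using that by (simp add: complex_norm_square[symmetric])
    then have zz: "z ^ k * cnj z ^ k = 1" for k by (metis power_mult_distrib power_one)
    show ?thesis
    proof (cases "N \<le> i")
      case True
      then have "z ^ i = z ^ (i - N) * z ^ N" by (simp add: power_add[symmetric])
      then show ?thesis using zz[of N] True by (simp add: m_def mult.assoc)
    next
      case False
      then have "cnj z ^ N = cnj z ^ i * cnj z ^ (N - i)" by (simp add: power_add[symmetric])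
      then have "z ^ i * cnj z ^ N = (z ^ i * cnj z ^ i) * cnj z ^ (N - i)" by (simp add: mult.assoc)
      then show ?thesis using zz[of i] False by (simp add: m_def)
    qed
  qed
  have fs: "f z = (\<Sum>i\<le>n. coeff p i * m i z)" if "cmod z = 1" for z
  proof -
    have "z * cnj z = 1" using that by (simp add: complex_norm_square[symmetric])
    then have zz: "z ^ N * cnj z ^ N = 1" by (metis power_mult_distrib power_one)
    have "f z = f z * z ^ N * cnj z ^ N" using zz by (simp add: mult.assoc)
    also have "\<dots> = (\<Sum>i\<le>n. coeff p i * (z ^ i * cnj z ^ N))"
      unfolding f[OF that] poly_eq_sum_atMost[OF n(2)] by (simp add: sum_distrib_right mult.assoc)
    finally show ?thesis unfolding m[OF that] .
  qed
  have cm: "continuous_on S (m i)" for S i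
    unfolding m_def by (cases "N \<le> i") (auto intro!: continuous_intros)
  have mint: "(\<integral>z. m i z \<partial>M) = (\<integral>z. m i z \<partial>M')" if "i \<le> n" for i
    using mom[of "i - N"] mom[of "N - i"] that n by (cases "N \<le> i") (simp_all add: m_def Bochner_Integration.integral_cnj del: complex_cnj_power)
  have "(\<integral>z. f z \<partial>L) = (\<Sum>i\<le>n. coeff p i * (\<integral>z. m i z \<partial>L))" if "circle_measure L" for L
  proof -
    interpret circle_measure L by (rule that)
    have "(\<integral>z. f z \<partial>L) = (\<integral>z. (\<Sum>i\<le>n. coeff p i * m i z) \<partial>L)"
      by (intro Bochner_Integration.integral_cong refl fs cmod_space)
    also have "\<dots> = (\<Sum>i\<le>n. \<integral>z. coeff p i * m i z \<partial>L)"
      by (intro Bochner_Integration.integral_sum integrable_continuous continuous_intros cm)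
    finally show ?thesis by simp
  qed
  then show ?thesis using M mint by simp
qed

subsection \<open>The entropy inequality\<close>

lemma ln_lipschitz:
  fixes x y m :: real
  assumes "0 < m" "m \<le> x" "m \<le> y"
  shows "ln x - ln y \<le> \<bar>x - y\<bar> / m"
proof -
  have "ln x - ln y \<le> (x - y) / y" by (rule ln_diff_le) (use assms in auto)
  also have "\<dots> \<le> \<bar>x - y\<bar> / y" using assms by (intro divide_right_mono) auto
  also have "\<dots> \<le> \<bar>x - y\<bar> / m" using assms by (intro divide_left_mono) auto
  finally show ?thesis .
qed

context nontrivial_circle_measure
begin

abbreviation "alpha \<equiv> verblunsky M"

text \<open>Both measures obey \<open>szego_orth\<close> with the same coefficients:
  \<open>M\<close> by \<open>verblunsky_szego\<close>, the Bernstein-Szego measure directly at level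
  n and by descent below it.\<close>

lemma bs_moments:
  assumes "k \<le> n"
  shows "(\<integral>z. z ^ k \<partial>circle_ac (bs_weight alpha n)) = (\<integral>z. z ^ k \<partial>M)"
proof (rule moments_determined[where a = alpha and n = n])
  show C: "circle_measure (circle_ac (bs_weight alpha n))"
    by (intro circle_measure_circle_ac continuous_bs_weight verblunsky_less_1)
  show "circle_measure M" by unfold_locales
  show "szego_orth (circle_ac (bs_weight alpha n)) alpha j" if "j \<le> n" for j
    using circle_measure.szego_orth_le[OF C szego_orth_bs_weight[of alpha n, OF verblunsky_less_1] verblunsky_less_1 that] .
  show "szego_orth M alpha j" for j using verblunsky_szego by blast
qed (rule assms)

lemma bs_total: "(\<integral>\<theta>. bs_weight alpha n \<theta> \<partial>angle_measure) = 1"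
proof -
  have "(\<integral>z. z ^ 0 \<partial>circle_ac (bs_weight alpha n)) = (\<integral>z. z ^ 0 \<partial>M)" by (rule bs_moments) simp
  also have "\<dots> = 1" by (simp add: prob_space)
  also have "(\<integral>z. z ^ 0 \<partial>circle_ac (bs_weight alpha n)) = (\<integral>\<theta>. bs_weight alpha n \<theta> *\<^sub>R (cis \<theta> ^ 0) \<partial>angle_measure)"
    by (rule integral_circle_ac)
      (use bs_weight_pos[of alpha n, OF verblunsky_less_1] borel_measurable_continuous_onI[OF continuous_bs_weight[of alpha UNIV n, OF verblunsky_less_1]] in \<open>auto intro: less_imp_le\<close>)
  also have "\<dots> = of_real (\<integral>\<theta>. bs_weight alpha n \<theta> \<partial>angle_measure)"
    by (simp add: scaleR_conv_of_real)
  finally show ?thesis by (metis of_real_eq_1_iff)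
qed

text \<open>A trigonometric polynomial near f has the same integral under w_n and under
  \<open>M\<close> once n is large. Then ln x <= x - 1 at x = f w_n, weighted by 1 - cos, gives the
  bound; the 2 on the right is the maximum of the weight.\<close>

lemma integral_ge_log_continuous:
  fixes f :: "complex \<Rightarrow> real"
  assumes L: "\<And>n. L \<le> (\<integral>\<theta>. (1 - cos \<theta>) * ln (bs_weight alpha n \<theta>) \<partial>angle_measure)"
    and f: "continuous_on (sphere 0 1) f" "\<And>z. z \<in> sphere 0 1 \<Longrightarrow> f z > 0"
  shows "1 + (\<integral>\<theta>. (1 - cos \<theta>) * ln (f (cis \<theta>)) \<partial>angle_measure) + L \<le> 2 * (\<integral>z. f z \<partial>M)"
proof (rule field_le_epsilon)
  fix e :: real assume e: "e > 0"
  \<comment> \<open>Replacing f by g costs e/4 under w_n and again e/4 under \<open>M\<close>; the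
    factor 2 turns this into e.\<close>
  obtain g where g: "real_polynomial_function g" "\<And>z. z \<in> sphere 0 1 \<Longrightarrow> \<bar>f z - g z\<bar> < e / 4"
    using Stone_Weierstrass_real_polynomial_function[OF compact_sphere f(1), of "e / 4"] e by auto
  obtain N p where p: "\<And>z. cmod z = 1 \<Longrightarrow> of_real (g z) * z ^ N = poly p z"
    using real_polynomial_function_trig_poly[OF g(1)] unfolding trig_poly_def by blast
  \<comment> \<open>Large enough for \<open>bs_moments\<close> to supply every moment entering g. It
    depends on e through g, so \<open>L\<close> has to be a bound for all n.\<close>
  define n where "n = max N (degree p)"
  let ?w = "bs_weight alpha n"
  have wpos: "?w \<theta> > 0" for \<theta> by (intro bs_weight_pos verblunsky_less_1)
  have wc: "continuous_on S ?w" for S by (intro continuous_bs_weight verblunsky_less_1)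
  have C: "circle_measure (circle_ac ?w)" by (intro circle_measure_circle_ac wc)
  have gc: "continuous_on S g" for S
    using g(1) by (simp add: continuous_on_polymonial_function real_polynomial_function_eq)
  have fc: "continuous_on S (\<lambda>\<theta>. f (cis \<theta>))" for S
    by (rule continuous_on_compose2[OF f(1)]) (auto intro!: continuous_intros)
  have gcc: "continuous_on S (\<lambda>\<theta>. g (cis \<theta>))" for S
    by (rule continuous_on_compose2[OF gc[of UNIV]]) (auto intro!: continuous_intros)
  have fpos: "f (cis \<theta>) > 0" for \<theta> by (rule f(2)) simp
  have "(\<integral>z. of_real (g z) \<partial>circle_ac ?w) = (\<integral>z. complex_of_real (g z) \<partial>M)"
    by (rule integral_trig_poly_eq[where n=n and N=N and p=p])
      (use C p bs_moments in \<open>auto simp: n_def circle_measure_axioms\<close>)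
  then have "(\<integral>z. g z \<partial>circle_ac ?w) = (\<integral>z. g z \<partial>M)" by simp
  moreover have "(\<integral>z. g z \<partial>circle_ac ?w) = (\<integral>\<theta>. ?w \<theta> *\<^sub>R g (cis \<theta>) \<partial>angle_measure)"
    by (rule integral_circle_ac)
      (use wpos borel_measurable_continuous_onI[OF wc] borel_measurable_continuous_on_restrict[OF gc] in \<open>auto simp: circle_borel_def intro: less_imp_le\<close>)
  ultimately have gg: "(\<integral>\<theta>. ?w \<theta> * g (cis \<theta>) \<partial>angle_measure) = (\<integral>z. g z \<partial>M)" by simp
  have "(\<integral>\<theta>. ?w \<theta> * f (cis \<theta>) \<partial>angle_measure) \<le> (\<integral>\<theta>. ?w \<theta> * g (cis \<theta>) + ?w \<theta> * (e / 4) \<partial>angle_measure)"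
  proof (rule integral_mono)
    fix \<theta>
    have "\<bar>f (cis \<theta>) - g (cis \<theta>)\<bar> < e / 4" by (rule g(2)) simp
    then have "f (cis \<theta>) \<le> g (cis \<theta>) + e / 4" by linarith
    then have "?w \<theta> * f (cis \<theta>) \<le> ?w \<theta> * (g (cis \<theta>) + e / 4)" using wpos[of \<theta>] by (intro mult_left_mono) auto
    then show "?w \<theta> * f (cis \<theta>) \<le> ?w \<theta> * g (cis \<theta>) + ?w \<theta> * (e / 4)" by (simp add: distrib_left)
  qed (intro integrable_angle_continuous continuous_intros wc fc gcc)+
  also have "\<dots> = (\<integral>\<theta>. ?w \<theta> * g (cis \<theta>) \<partial>angle_measure) + (\<integral>\<theta>. ?w \<theta> * (e / 4) \<partial>angle_measure)"
    by (intro Bochner_Integration.integral_add integrable_angle_continuous continuous_intros wc gcc)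
  also have "\<dots> = (\<integral>z. g z \<partial>M) + e / 4" using bs_total[of n] gg by simp
  also have "(\<integral>z. g z \<partial>M) \<le> (\<integral>z. f z + e / 4 \<partial>M)"
  proof (rule integral_mono)
    fix z assume "z \<in> space M"
    then have "\<bar>f z - g z\<bar> < e / 4" by (intro g(2)) (simp add: space_M)
    then show "g z \<le> f z + e / 4" by linarith
  qed (intro integrable_continuous continuous_intros gc f(1))+
  also have "\<dots> = (\<integral>z. f z \<partial>M) + e / 4"
    by (subst Bochner_Integration.integral_add) (auto intro: integrable_continuous f(1) simp: prob_space)
  finally have up: "(\<integral>\<theta>. ?w \<theta> * f (cis \<theta>) \<partial>angle_measure) \<le> (\<integral>z. f z \<partial>M) + e / 2" by simp
  have "(\<integral>\<theta>. (1 - cos \<theta>) + (1 - cos \<theta>) * ln (f (cis \<theta>)) + (1 - cos \<theta>) * ln (?w \<theta>) \<partial>angle_measure)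
      \<le> (\<integral>\<theta>. (1 - cos \<theta>) * (?w \<theta> * f (cis \<theta>)) \<partial>angle_measure)"
  proof (rule integral_mono)
    fix \<theta>
    have "1 + (ln (f (cis \<theta>)) + ln (?w \<theta>)) \<le> ?w \<theta> * f (cis \<theta>)"
      using ln_le_minus_one[of "?w \<theta> * f (cis \<theta>)"] fpos[of \<theta>] wpos[of \<theta>] by (simp add: ln_mult)
    then have "(1 - cos \<theta>) * (1 + (ln (f (cis \<theta>)) + ln (?w \<theta>))) \<le> (1 - cos \<theta>) * (?w \<theta> * f (cis \<theta>))"
      by (intro mult_left_mono) auto
    then show "(1 - cos \<theta>) + (1 - cos \<theta>) * ln (f (cis \<theta>)) + (1 - cos \<theta>) * ln (?w \<theta>) \<le> (1 - cos \<theta>) * (?w \<theta> * f (cis \<theta>))"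
      by (simp add: algebra_simps)
  qed (use fpos wpos in \<open>intro integrable_angle_continuous continuous_intros wc fc; auto simp: less_imp_neq[symmetric]\<close>)+
  also have "\<dots> \<le> 2 * (\<integral>\<theta>. ?w \<theta> * f (cis \<theta>) \<partial>angle_measure)"
    by (intro integral_weight_le integrable_angle_continuous continuous_intros wc fc AE_I2 mult_nonneg_nonneg)
      (use fpos wpos in \<open>auto intro: less_imp_le\<close>)
  also have "(\<integral>\<theta>. (1 - cos \<theta>) + (1 - cos \<theta>) * ln (f (cis \<theta>)) + (1 - cos \<theta>) * ln (?w \<theta>) \<partial>angle_measure)
     = (\<integral>\<theta>. (1 - cos \<theta>) + (1 - cos \<theta>) * ln (f (cis \<theta>)) \<partial>angle_measure) + (\<integral>\<theta>. (1 - cos \<theta>) * ln (?w \<theta>) \<partial>angle_measure)"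
    by (rule Bochner_Integration.integral_add)
       (use fpos wpos in \<open>intro integrable_angle_continuous continuous_intros wc fc; auto simp: less_imp_neq[symmetric]\<close>)+
  also have "(\<integral>\<theta>. (1 - cos \<theta>) + (1 - cos \<theta>) * ln (f (cis \<theta>)) \<partial>angle_measure) =
    (\<integral>\<theta>. 1 - cos \<theta> \<partial>angle_measure) + (\<integral>\<theta>. (1 - cos \<theta>) * ln (f (cis \<theta>)) \<partial>angle_measure)"
    by (rule Bochner_Integration.integral_add)
       (use fpos wpos in \<open>intro integrable_angle_continuous continuous_intros wc fc; auto simp: less_imp_neq[symmetric]\<close>)+
  finally have "1 + (\<integral>\<theta>. (1 - cos \<theta>) * ln (f (cis \<theta>)) \<partial>angle_measure) + L \<le> 2 * (\<integral>\<theta>. ?w \<theta> * f (cis \<theta>) \<partial>angle_measure)"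
    using L[of n] unfolding integral_one_minus_cos by linarith
  also have "\<dots> \<le> 2 * (\<integral>z. f z \<partial>M) + e" using up by simp
  finally show "1 + (\<integral>\<theta>. (1 - cos \<theta>) * ln (f (cis \<theta>)) \<partial>angle_measure) + L \<le> 2 * (\<integral>z. f z \<partial>M) + e" .
qed

text \<open>A continuous g close to f in L^1 of both measures transfers the continuous case. Values
  in [m, B] make ln Lipschitz with constant 1 / m, which controls the logarithmic side.\<close>

lemma integral_ge_log:
  fixes f :: "complex \<Rightarrow> real"
  assumes L: "\<And>n. L \<le> (\<integral>\<theta>. (1 - cos \<theta>) * ln (bs_weight alpha n \<theta>) \<partial>angle_measure)"
    and f [measurable]: "f \<in> borel_measurable borel" and m: "0 < m" and fb: "\<And>z. m \<le> f z" "\<And>z. f z \<le> B"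
  shows "1 + (\<integral>\<theta>. (1 - cos \<theta>) * ln (f (cis \<theta>)) \<partial>angle_measure) + L \<le> 2 * (\<integral>z. f z \<partial>M)"
proof (rule field_le_epsilon)
  fix e :: real assume e: "e > 0"
  \<comment> \<open>The logarithmic side loses at most \<open>2 * d / m\<close> and the integral
    against \<open>M\<close> at most \<open>2 * d\<close>; together this is e.\<close>
  define d where "d = e / (2 + 2 / m)"
  have "2 + 2 / m > 0" using m by (simp add: add_pos_pos)
  moreover have "2 * d / m + 2 * d = d * (2 + 2 / m)" by (simp add: algebra_simps)
  ultimately have d: "d > 0" "2 * d / m + 2 * d = e" using e by (simp_all add: d_def)
  have [measurable]: "cis \<in> borel_measurable borel"
    by (intro borel_measurable_continuous_onI continuous_intros)
  have idm [measurable]: "(\<lambda>z. z) \<in> measurable M borel" by (rule measurable_M) simp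
  let ?N1 = "distr M borel (\<lambda>z. z)" and ?N2 = "distr angle_measure borel cis"
  let ?S = "add_measure ?N1 ?N2"
  have emS: "emeasure ?S A = emeasure ?N1 A + emeasure ?N2 A" if "A \<in> sets ?S" for A
    using that by (intro emeasure_add_measure) auto
  interpret N1: prob_space ?N1 by (rule prob_space_distr) simp
  interpret N2: prob_space ?N2 by (rule angle.prob_space_distr) simp
  have finS: "finite_measure ?S"
  proof (rule finite_measureI)
    have "emeasure ?S (space ?S) = emeasure ?N1 (space ?S) + emeasure ?N2 (space ?S)" by (rule emS[OF sets.top])
    then show "emeasure ?S (space ?S) \<noteq> \<infinity>" using N1.emeasure_finite N2.emeasure_finite by simp
  qed
  interpret S: finite_measure ?S by (rule finS)
  have "integrable ?S f"
  proof (rule S.integrable_const_bound[where B=B])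
    have "norm (f z) \<le> B" for z using fb[of z] m by simp
    then show "AE z in ?S. norm (f z) \<le> B" by simp
    show "f \<in> borel_measurable ?S"
      by (subst measurable_cong_sets[of _ borel _ borel]) simp_all
  qed
  then obtain g0 where g0: "continuous_on UNIV g0" "integrable ?S g0" "(\<integral>z. \<bar>f z - g0 z\<bar> \<partial>?S) < d"
    using continuous_dense_L1[OF finS _ _ d(1), of f] by auto
  \<comment> \<open>Clipping to an interval that contains the values of f cannot increase the
    distance to f, and it gives the lower bound needed under the logarithm.\<close>
  define g where "g z = max m (min B (g0 z))" for z
  have gc: "continuous_on UNIV g" unfolding g_def by (intro continuous_intros g0)
  then have [measurable]: "g \<in> borel_measurable borel" by (rule borel_measurable_continuous_onI)
  have [measurable]: "g0 \<in> borel_measurable borel" by (rule borel_measurable_continuous_onI[OF g0(1)])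
  have mB: "m \<le> B" using fb[of 0] by linarith
  have gb: "m \<le> g z" "g z \<le> B" for z using mB by (auto simp: g_def)
  have fg: "\<bar>f z - g z\<bar> \<le> \<bar>f z - g0 z\<bar>" for z using fb[of z] by (auto simp: g_def)
  have bd: "\<bar>f z - g z\<bar> \<le> B" for z using fb[of z] gb[of z] m by auto
  have "ennreal (\<integral>z. \<bar>f z - g z\<bar> \<partial>M) + ennreal (\<integral>\<theta>. \<bar>f (cis \<theta>) - g (cis \<theta>)\<bar> \<partial>angle_measure)
    = (\<integral>\<^sup>+z. \<bar>f z - g z\<bar> \<partial>M) + (\<integral>\<^sup>+\<theta>. \<bar>f (cis \<theta>) - g (cis \<theta>)\<bar> \<partial>angle_measure)"
    using bd by (subst (1 2) nn_integral_eq_integral)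
      (auto intro!: integrable_const_bound[where B=B] angle.integrable_const_bound[where B=B])
  also have "\<dots> = (\<integral>\<^sup>+z. \<bar>f z - g z\<bar> \<partial>?N1) + (\<integral>\<^sup>+z. \<bar>f z - g z\<bar> \<partial>?N2)"
    by (simp add: nn_integral_distr)
  also have "\<dots> = (\<integral>\<^sup>+z. \<bar>f z - g z\<bar> \<partial>?S)"
    by (rule nn_integral_emeasure_add[symmetric], simp, simp, rule emS, simp, subst measurable_cong_sets[of _ borel _ borel]) simp_all
  also have "\<dots> \<le> (\<integral>\<^sup>+z. \<bar>f z - g0 z\<bar> \<partial>?S)" using fg by (intro nn_integral_mono ennreal_leI) auto
  also have "\<dots> = ennreal (\<integral>z. \<bar>f z - g0 z\<bar> \<partial>?S)"
    using \<open>integrable ?S f\<close> g0(2) by (intro nn_integral_eq_integral) auto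
  also have "\<dots> \<le> ennreal d" using g0(3) by (intro ennreal_leI) auto
  finally have le: "(\<integral>z. \<bar>f z - g z\<bar> \<partial>M) + (\<integral>\<theta>. \<bar>f (cis \<theta>) - g (cis \<theta>)\<bar> \<partial>angle_measure) \<le> d"
    using d(1) by (simp add: ennreal_plus[symmetric] del: ennreal_plus)
  have nn: "0 \<le> (\<integral>z. \<bar>f z - g z\<bar> \<partial>M)" "0 \<le> (\<integral>\<theta>. \<bar>f (cis \<theta>) - g (cis \<theta>)\<bar> \<partial>angle_measure)"
    by (intro Bochner_Integration.integral_nonneg; simp)+
  have ig: "integrable M g" "integrable M f" "integrable M (\<lambda>z. \<bar>f z - g z\<bar>)"
  proof -
    have "norm (f z) \<le> B" "norm (g z) \<le> B" for z using fb[of z] gb[of z] m by simp_all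
    then show "integrable M g" "integrable M f" by (intro integrable_const_bound[where B=B]; simp)+
    then show "integrable M (\<lambda>z. \<bar>f z - g z\<bar>)" by simp
  qed
  have iln: "integrable angle_measure (\<lambda>\<theta>. (1 - cos \<theta>) * ln (h (cis \<theta>)))"
    if "h \<in> borel_measurable borel" "\<And>z. m \<le> h z" "\<And>z. h z \<le> B" for h
    using that by (intro integrable_log_bounded[OF _ m, of _ B]) auto
  have if': "integrable angle_measure (\<lambda>\<theta>. \<bar>f (cis \<theta>) - g (cis \<theta>)\<bar>)"
    using bd by (intro angle.integrable_const_bound[where B=B]) auto
  have "(\<integral>\<theta>. (1 - cos \<theta>) * ln (f (cis \<theta>)) \<partial>angle_measure) \<le>
     (\<integral>\<theta>. (1 - cos \<theta>) * ln (g (cis \<theta>)) + 2 / m * \<bar>f (cis \<theta>) - g (cis \<theta>)\<bar> \<partial>angle_measure)"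
  proof (rule integral_mono)
    fix \<theta>
    have "(1 - cos \<theta>) * (ln (f (cis \<theta>)) - ln (g (cis \<theta>))) \<le> (1 - cos \<theta>) * (\<bar>f (cis \<theta>) - g (cis \<theta>)\<bar> / m)"
      using fb gb m by (intro mult_left_mono ln_lipschitz) auto
    also have "\<dots> \<le> 2 * (\<bar>f (cis \<theta>) - g (cis \<theta>)\<bar> / m)"
      using cos_ge_minus_one[of \<theta>] m by (intro mult_right_mono) auto
    finally show "(1 - cos \<theta>) * ln (f (cis \<theta>)) \<le> (1 - cos \<theta>) * ln (g (cis \<theta>)) + 2 / m * \<bar>f (cis \<theta>) - g (cis \<theta>)\<bar>"
      by (simp add: algebra_simps)
  qed (use if' in \<open>auto intro!: iln fb gb\<close>)
  also have "\<dots> = (\<integral>\<theta>. (1 - cos \<theta>) * ln (g (cis \<theta>)) \<partial>angle_measure) + 2 / m * (\<integral>\<theta>. \<bar>f (cis \<theta>) - g (cis \<theta>)\<bar> \<partial>angle_measure)"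
    using if' by (subst Bochner_Integration.integral_add) (auto intro!: iln gb)
  also have "\<dots> \<le> (\<integral>\<theta>. (1 - cos \<theta>) * ln (g (cis \<theta>)) \<partial>angle_measure) + 2 / m * d"
  proof (intro add_left_mono mult_left_mono)
    show "(\<integral>\<theta>. \<bar>f (cis \<theta>) - g (cis \<theta>)\<bar> \<partial>angle_measure) \<le> d" using le nn by linarith
  qed (use m in simp)
  finally have a1: "(\<integral>\<theta>. (1 - cos \<theta>) * ln (f (cis \<theta>)) \<partial>angle_measure) \<le>
     (\<integral>\<theta>. (1 - cos \<theta>) * ln (g (cis \<theta>)) \<partial>angle_measure) + 2 * d / m" by simp
  have a2: "1 + (\<integral>\<theta>. (1 - cos \<theta>) * ln (g (cis \<theta>)) \<partial>angle_measure) + L \<le> 2 * (\<integral>z. g z \<partial>M)"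
    using gb m by (intro integral_ge_log_continuous L continuous_on_subset[OF gc]) (auto intro: less_le_trans)
  have "(\<integral>z. g z \<partial>M) \<le> (\<integral>z. f z + \<bar>f z - g z\<bar> \<partial>M)"
    using ig by (intro integral_mono) auto
  also have "\<dots> = (\<integral>z. f z \<partial>M) + (\<integral>z. \<bar>f z - g z\<bar> \<partial>M)"
    using ig by (intro Bochner_Integration.integral_add) auto
  finally have "(\<integral>z. g z \<partial>M) \<le> (\<integral>z. f z \<partial>M) + d" using le nn by linarith
  then show "1 + (\<integral>\<theta>. (1 - cos \<theta>) * ln (f (cis \<theta>)) \<partial>angle_measure) + L \<le> 2 * (\<integral>z. f z \<partial>M) + e"
    using a1 a2 d(2) by linarith
qed

end

subsection \<open>The sum rule and the logarithmic integral\<close>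

text \<open>Polarization writes Re (a_(j+1) cnj a_j) as half of |a_(j+1)|^2 + |a_j|^2 - |a_(j+1) -
  a_j|^2. Each interior |a_j|^2 is collected in full and joins its logarithm; the two ends get only
  half, hence the corrections.\<close>

lemma log_szego_norm_add_coeff:
  assumes "\<And>j. cmod (a j) < 1"
  shows "ln (szego_norm a (Suc m)) + Re (coeff (Psi a (Suc m)) 1) =
    (\<Sum>j\<le>m. ln (1 - (cmod (a j))\<^sup>2) + (cmod (a j))\<^sup>2) - (\<Sum>j<m. (cmod (a (j + 1) - a j))\<^sup>2) / 2
      - (cmod (a 0))\<^sup>2 / 2 - (cmod (a m))\<^sup>2 / 2 - Re (a 0)"
proof (induction m)
  case 0
  show ?case unfolding coeff_Psi_1 by (simp add: szego_norm_def)
next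
  case (Suc m)
  have pos: "1 - (cmod (a j))\<^sup>2 > 0" for j using assms[of j] by (simp add: abs_square_less_1)
  have "szego_norm a (Suc (Suc m)) = szego_norm a (Suc m) * (1 - (cmod (a (Suc m)))\<^sup>2)"
    by (simp add: szego_norm_def)
  then have ln: "ln (szego_norm a (Suc (Suc m))) = ln (szego_norm a (Suc m)) + ln (1 - (cmod (a (Suc m)))\<^sup>2)"
    using szego_norm_pos[of "Suc m" a, OF assms] pos[of "Suc m"] by (simp only: ln_mult_pos)
  have co: "Re (coeff (Psi a (Suc (Suc m))) 1) = Re (coeff (Psi a (Suc m)) 1) + Re (a (Suc m) * cnj (a m))"
    unfolding coeff_Psi_1 sum.lessThan_Suc[of _ "Suc m"] coeff_Phi_Suc_0 by simp
  have "(cmod (a (Suc m) - a m))\<^sup>2 = (cmod (a (Suc m)))\<^sup>2 + (cmod (a m))\<^sup>2 - 2 * Re (a (Suc m) * cnj (a m))"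
    unfolding cmod_power2 by (simp add: power2_eq_square algebra_simps)
  then show ?case using Suc unfolding ln co by (simp add: field_simps)
qed

text \<open>The difference of the sides is 0 at 0 and has derivative -y^2 / (1 - y). At x = |a_j|^2
  this is how the fourth powers enter.\<close>

lemma ln_one_minus_add_le:
  fixes x :: real
  assumes "0 \<le> x" "x < 1"
  shows "ln (1 - x) + x \<le> - x\<^sup>2 / 2"
proof -
  have "ln (1 - x) + x + x\<^sup>2 / 2 \<le> ln (1 - 0) + 0 + 0\<^sup>2 / 2"
  proof (rule DERIV_nonpos_imp_nonincreasing[OF assms(1)])
    fix y assume y: "0 \<le> y" "y \<le> x"
    have "((\<lambda>y. ln (1 - y) + y + y\<^sup>2 / 2) has_real_derivative (- 1 / (1 - y) + 1 + y)) (at y)"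
      using y assms by (auto intro!: derivative_eq_intros)
    moreover have "- 1 / (1 - y) + 1 + y = - (y\<^sup>2 / (1 - y))"
      using y assms by (simp add: field_simps power2_eq_square)
    moreover have "- (y\<^sup>2 / (1 - y)) \<le> 0" using y assms by simp
    ultimately show "\<exists>z. ((\<lambda>y. ln (1 - y) + y + y\<^sup>2 / 2) has_real_derivative z) (at y) \<and> z \<le> 0"
      by metis
  qed
  then show ?thesis by simp
qed

text \<open>Apart from bounded end terms, every term of the sum rule is nonpositive. The logarithmic
  terms lie below -|a_j|^4 / 2 always and above -2 |a_j|^4 for small a_j, so no cancellation can
  hide a divergent series.\<close>

lemma sums_finite_iff_bounded_below:
  assumes a: "\<And>j. cmod (a j) < 1"
  shows "(\<Sum>j. ennreal (cmod (a (j + 1) - a j) ^ 2)) + (\<Sum>j. ennreal (cmod (a j) ^ 4)) < \<infinity>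
    \<longleftrightarrow> (\<exists>L. \<forall>n. L \<le> ln (szego_norm a n) + Re (coeff (Psi a n) 1))" (is "?S \<longleftrightarrow> (\<exists>L. \<forall>n. L \<le> ?Z n)")
proof
  let ?u = "\<lambda>j. ln (1 - (cmod (a j))\<^sup>2) + (cmod (a j))\<^sup>2"
  let ?d = "\<lambda>j. (cmod (a (j + 1) - a j))\<^sup>2"
  have x: "0 \<le> (cmod (a j))\<^sup>2" "(cmod (a j))\<^sup>2 < 1" for j using a[of j] by (auto simp: abs_square_less_1)
  have u: "?u j \<le> - (cmod (a j) ^ 4) / 2" for j
    using ln_one_minus_add_le[OF x[of j]] by simp
  have re: "\<bar>Re (a 0)\<bar> \<le> 1" using a[of 0] abs_Re_le_cmod[of "a 0"] by linarith
  show "\<exists>L. \<forall>n. L \<le> ?Z n" if ?S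
  proof -
    have sd: "summable ?d" and s4: "summable (\<lambda>j. cmod (a j) ^ 4)"
      using that by (auto intro!: summable_suminf_not_top)
    have "(\<lambda>j. cmod (a j) ^ 4) \<longlonglongrightarrow> 0" by (rule summable_LIMSEQ_zero[OF s4])
    \<comment> \<open>This gives |a_j|^2 <= 1/2, the range of the quadratic lower bound for ln (1 -
      x) used below.\<close>
    then have ev: "\<forall>\<^sub>F j in sequentially. cmod (a j) ^ 4 < 1 / 4" by (rule order_tendstoD) simp
    have "\<forall>\<^sub>F j in sequentially. norm (- ?u j) \<le> 2 * cmod (a j) ^ 4"
      using ev
    proof eventually_elim
      case (elim j)
      have "((cmod (a j))\<^sup>2)\<^sup>2 \<le> (1 / 2)\<^sup>2" using elim by (simp add: power_mult[symmetric] power_one_over)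
      then have "(cmod (a j))\<^sup>2 \<le> 1 / 2" by (rule power2_le_imp_le) simp
      then have "- (cmod (a j))\<^sup>2 - 2 * ((cmod (a j))\<^sup>2)\<^sup>2 \<le> ln (1 - (cmod (a j))\<^sup>2)"
        by (intro ln_one_minus_pos_lower_bound x)
      moreover have "((cmod (a j))\<^sup>2)\<^sup>2 = cmod (a j) ^ 4" by simp
      moreover have "?u j \<le> 0" using u[of j] zero_le_power[OF norm_ge_zero, of "a j" 4] by linarith
      ultimately show ?case unfolding real_norm_def by linarith
    qed
    then have su: "summable (\<lambda>j. - ?u j)"
      by (rule summable_comparison_test_ev) (intro summable_mult s4)
    \<comment> \<open>The 2 is 1/2 + 1/2 + 1, a bound for the end terms |a 0|^2 / 2, |a m|^2 / 2 and
      Re (a 0).\<close>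
    define L where "L = - (\<Sum>j. - ?u j) - (\<Sum>j. ?d j) / 2 - 2"
    have nnu: "0 \<le> - ?u j" for j using u[of j] zero_le_power[OF norm_ge_zero, of "a j" 4] by linarith
    \<comment> \<open>The sum rule starts at level 1; at level 0 the quantity is 0, hence the
      minimum.\<close>
    have "min 0 L \<le> ?Z n" for n
    proof (cases n)
      case 0
      then show ?thesis by (simp add: szego_norm_def)
    next
      case (Suc m)
      have "(\<Sum>j\<le>m. - ?u j) \<le> (\<Sum>j. - ?u j)" by (rule sum_le_suminf[OF su]) (simp, rule nnu)
      moreover have "(\<Sum>j<m. ?d j) \<le> (\<Sum>j. ?d j)" by (intro sum_le_suminf sd) auto
      ultimately have "L \<le> ?Z (Suc m)"
        using log_szego_norm_add_coeff[of a m, OF a] x[of 0] x[of m] re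
        unfolding sum_negf L_def by linarith
      then show ?thesis unfolding Suc by linarith
    qed
    then show ?thesis by blast
  qed
  show ?S if "\<exists>L. \<forall>n. L \<le> ?Z n"
  proof -
    obtain L where L: "\<And>n. L \<le> ?Z n" using \<open>\<exists>L. \<forall>n. L \<le> ?Z n\<close> by blast
    \<comment> \<open>The end squares have a favourable sign and are dropped; the 1 bounds
      \<open>- Re (a 0)\<close>, and the 2 clears the halves.\<close>
    have bound: "(\<Sum>j\<le>m. cmod (a j) ^ 4) + (\<Sum>j<m. ?d j) \<le> 2 * (1 - L)" for m
    proof -
      have "(\<Sum>j\<le>m. ?u j) \<le> (\<Sum>j\<le>m. - (cmod (a j) ^ 4) / 2)" by (intro sum_mono u)
      also have "\<dots> = - (\<Sum>j\<le>m. cmod (a j) ^ 4) / 2"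
        by (simp add: sum_negf sum_divide_distrib)
      finally have U: "(\<Sum>j\<le>m. ?u j) \<le> - (\<Sum>j\<le>m. cmod (a j) ^ 4) / 2" .
      have "- Re (a 0) \<le> 1" using re by linarith
      then show ?thesis
        using L[of "Suc m", unfolded log_szego_norm_add_coeff[of a m, OF a]] x(1)[of 0] x(1)[of m] U
        by argo
    qed
    have "(\<Sum>j<m. cmod (a j) ^ 4) \<le> 2 * (1 - L)" "(\<Sum>j<m. ?d j) \<le> 2 * (1 - L)" for m
    proof -
      have "(\<Sum>j<m. cmod (a j) ^ 4) \<le> (\<Sum>j\<le>m. cmod (a j) ^ 4)" by (intro sum_mono2) auto
      moreover have "0 \<le> (\<Sum>j<m. ?d j)" "0 \<le> (\<Sum>j\<le>m. cmod (a j) ^ 4)" by (intro sum_nonneg; simp)+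
      ultimately show "(\<Sum>j<m. cmod (a j) ^ 4) \<le> 2 * (1 - L)" "(\<Sum>j<m. ?d j) \<le> 2 * (1 - L)"
        using bound[of m] by linarith+
    qed
    then have "(\<Sum>j. ennreal (cmod (a j) ^ 4)) \<le> ennreal (2 * (1 - L))" "(\<Sum>j. ennreal (?d j)) \<le> ennreal (2 * (1 - L))"
      by (intro suminf_le_const summableI; simp add: sum_ennreal ennreal_leI)+
    then have "(\<Sum>j. ennreal (cmod (a j) ^ 4)) < \<top>" "(\<Sum>j. ennreal (?d j)) < \<top>"
      by (auto intro: order_le_less_trans[OF _ ennreal_less_top])
    then show ?S by simp
  qed
qed

section \<open>The angle coordinate and truncated logarithms\<close>

lemma AE_angle_measureI: "(AE \<theta> in lborel. P \<theta>) \<Longrightarrow> (AE \<theta> in angle_measure. P \<theta>)"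
  unfolding angle_measure_eq_density by (subst AE_density) auto

text \<open>In [0, 2 pi) the weight 1 - cos vanishes only at 0. Where it is positive, a finite
  weighted logarithm forces w > 0.\<close>

lemma AE_cos_less_1: "AE \<theta> in angle_measure. cos \<theta> < 1"
proof -
  have "AE \<theta> in angle_measure. \<theta> \<noteq> 0" by (intro AE_angle_measureI AE_lborel_singleton)
  with AE_angle_measure show ?thesis
  proof eventually_elim
    case (elim \<theta>)
    have "cos \<theta> \<noteq> 1"
    proof
      assume "cos \<theta> = 1"
      then obtain n :: int where "\<theta> = of_int n * 2 * pi" by (auto simp: cos_one_2pi_int)
      with elim have "0 \<le> of_int n * (2 * pi)" "of_int n * (2 * pi) < 1 * (2 * pi)" "n \<noteq> 0" by (auto simp: mult.assoc)
      then have "0 \<le> n" "n < 1" "n \<noteq> 0"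
        using pi_gt_zero by (simp_all only: zero_le_mult_iff mult_less_cancel_right) auto
      then show False by simp
    qed
    then show ?case using cos_le_one[of \<theta>] by linarith
  qed
qed

text \<open>Cutting \<open>Arg2pi\<close> off on its branch cut makes Borel measurability immediate and keeps the value \<open>0\<close> at \<open>1\<close>.\<close>
definition circle_arg :: "complex \<Rightarrow> real" where
  "circle_arg z = indicator (- \<real>\<^sub>\<ge>\<^sub>0) z *\<^sub>R Arg2pi z"

lemma measurable_circle_arg [measurable]: "circle_arg \<in> borel_measurable borel"
  unfolding circle_arg_def
proof (rule borel_measurable_continuous_on_indicator)
  show "continuous_on (- \<real>\<^sub>\<ge>\<^sub>0) Arg2pi"
    using continuous_at_Arg2pi by (auto intro!: continuous_at_imp_continuous_on)
  show "- \<real>\<^sub>\<ge>\<^sub>0 \<in> sets (borel :: complex measure)" using closed_nonneg_Reals_complex by auto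
qed

lemma circle_arg_cis:
  assumes "\<theta> \<in> {0..<2 * pi}"
  shows "circle_arg (cis \<theta>) = \<theta>"
proof (cases "cis \<theta> \<in> \<real>\<^sub>\<ge>\<^sub>0")
  case True
  then have "Arg2pi (cis \<theta>) = 0" by (simp add: Arg2pi_eq_0 complex_nonneg_Reals_iff complex_is_Real_iff)
  moreover have "Arg2pi (cis \<theta>) = \<theta>" using assms by (intro Arg2pi_unique[of 1]) (auto simp: cis_conv_exp)
  ultimately show ?thesis using True by (simp add: circle_arg_def)
next
  case False
  moreover have "Arg2pi (cis \<theta>) = \<theta>" using assms by (intro Arg2pi_unique[of 1]) (auto simp: cis_conv_exp)
  ultimately show ?thesis by (simp add: circle_arg_def)
qed

lemma measurable_ext_log [measurable]: "ext_log \<in> borel_measurable borel"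
  unfolding ext_log_def by measurable

lemma e2ennreal_log_le:
  assumes "0 \<le> w" "0 \<le> c" "c \<le> 2"
  shows "e2ennreal (ereal c * ext_log w) \<le> ennreal (2 * w)"
proof (cases "w \<le> 0")
  case True
  then show ?thesis using assms(2) by (cases "c = 0") (auto simp: ext_log_def e2ennreal_neg)
next
  case False
  have "c * ln w \<le> 2 * w"
  proof -
    have "ln w \<le> w" using False ln_le_minus_one[of w] by linarith
    then have "c * ln w \<le> c * w" using assms by (intro mult_left_mono) auto
    also have "\<dots> \<le> 2 * w" using assms by (intro mult_right_mono) auto
    finally show ?thesis .
  qed
  then show ?thesis using False by (simp add: ext_log_def ennreal.abs_eq[symmetric] e2ennreal_ereal ennreal_leI)
qed

lemma e2ennreal_neg_log:
  "0 < w \<Longrightarrow> e2ennreal (- (ereal c * ext_log w)) = ennreal (- (c * ln w))"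
  by (simp add: ext_log_def e2ennreal_ereal)

text \<open>Raising w to at least 1 / (k + 1) makes the logarithm real. For w > 0 some k leaves w
  unchanged; for w <= 0 and c > 0 the truncations are unbounded; for c = 0 the left side is
  0.\<close>

lemma e2ennreal_neg_log_le_SUP:
  assumes "0 \<le> c"
  shows "e2ennreal (- (ereal c * ext_log w)) \<le> (SUP k. ennreal (c * max 0 (- ln (max (1 / real (Suc k)) w))))"
proof (cases "w \<le> 0")
  case True
  show ?thesis
  proof (cases "c = 0")
    case False
    then have c: "c > 0" using assms by simp
    have "\<exists>k\<in>UNIV. of_nat n \<le> ennreal (c * max 0 (- ln (max (1 / real (Suc k)) w)))" for n
    proof -
      obtain k :: nat where k: "exp (real n / c) \<le> real k" using real_arch_simple by blast
      then have "exp (real n / c) \<le> real (Suc k)" by simp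
      then have "real n / c \<le> ln (real (Suc k))" by (subst ln_ge_iff) auto
      then have "real n \<le> c * ln (real (Suc k))" using c by (simp add: field_simps)
      also have "\<dots> \<le> c * max 0 (- ln (max (1 / real (Suc k)) w))"
      proof -
        have "max (1 / real (Suc k)) w = 1 / real (Suc k)" using True by (intro max_absorb1) (simp add: order_trans[of w 0])
        then show ?thesis using c by (intro mult_left_mono) (simp_all add: ln_div)
      qed
      finally show ?thesis unfolding ennreal_of_nat_eq_real_of_nat by (intro bexI[of _ k] ennreal_leI) auto
    qed
    then have "(SUP k. ennreal (c * max 0 (- ln (max (1 / real (Suc k)) w)))) = \<top>"
      by (rule ennreal_SUP_eq_top)
    then show ?thesis by (simp only: top_greatest)
  qed (simp add: zero_ereal_def[symmetric])
next
  case False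
  obtain k :: nat where k: "1 / w \<le> real k" using real_arch_simple by blast
  then have "1 / real (Suc k) \<le> w" using False by (simp add: field_simps)
  then have "ennreal (- (c * ln w)) \<le> ennreal (c * max 0 (- ln (max (1 / real (Suc k)) w)))"
    using assms by (intro ennreal_leI) (simp add: max_def mult_nonneg_nonpos)
  also have "\<dots> \<le> (SUP k. ennreal (c * max 0 (- ln (max (1 / real (Suc k)) w))))"
    by (rule SUP_upper) simp
  finally show ?thesis using False by (simp add: e2ennreal_neg_log)
qed

text \<open>With x = w, \<open>1 / c\<close> is the test function of the entropy inequality. The
  fourth bound keeps its integral against w bounded independently of K. The last recovers the
  truncated negative logarithm, where \<open>2 * x\<close> pays for x > 1: there ln c may be
  positive, but it is at most x.\<close>

lemma inverse_clip_bounds: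
  fixes K x :: real
  assumes "K \<ge> 1" "x \<ge> 0"
  defines "c \<equiv> max (1 / K) (min K x)"
  shows "1 / K \<le> c" "c \<le> K" "0 < c" "x * (1 / c) \<le> 1 + x"
    "0 \<le> t \<Longrightarrow> t \<le> 2 \<Longrightarrow> t * max 0 (- ln (max (1 / K) x)) \<le> t * ln (1 / c) + 2 * x"
proof -
  have K: "1 / K \<le> 1" "1 / K > 0" using assms by simp_all
  show c1: "1 / K \<le> c" by (simp add: c_def)
  show "c \<le> K" unfolding c_def using assms(1) K(1) by linarith
  show c0: "0 < c" using c1 K by linarith
  have "x \<le> (1 + x) * c"
  proof (cases "x \<le> K")
    case True
    then have "x \<le> c" by (simp add: c_def)
    also have "\<dots> \<le> (1 + x) * c" using assms(2) c0 by (simp add: algebra_simps)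
    finally show ?thesis .
  next
    case False
    then have "1 \<le> c" using assms(1) by (simp add: c_def)
    then have "(1 + x) * 1 \<le> (1 + x) * c" using assms(2) by (intro mult_left_mono) auto
    then show ?thesis by simp
  qed
  then show "x * (1 / c) \<le> 1 + x" using c0 by (simp add: divide_le_eq)
  assume t: "0 \<le> t" "t \<le> 2"
  show "t * max 0 (- ln (max (1 / K) x)) \<le> t * ln (1 / c) + 2 * x"
  proof (cases "x \<le> 1")
    case True
    then have "c = max (1 / K) x" using assms(1) by (simp add: c_def)
    moreover have "c \<le> 1" using True K \<open>c = max (1 / K) x\<close> by simp
    ultimately show ?thesis using assms(2) c0 by (simp add: ln_div)
  next
    case False
    have "1 / K \<le> x" using False K by linarith
    then have "max (1 / K) x = x" by (rule max_absorb2)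
    moreover have "ln x \<ge> 0" using False by simp
    moreover have "ln c \<le> x"
    proof -
      have "c \<le> x" unfolding c_def using \<open>1 / K \<le> x\<close> by linarith
      then have "ln c \<le> ln x" using c0 by simp
      also have "\<dots> \<le> x" using ln_le_minus_one[of x] False by linarith
      finally show ?thesis .
    qed
    moreover have "t * ln c \<le> 2 * x"
    proof -
      have "t * ln c \<le> t * x" using t \<open>ln c \<le> x\<close> by (intro mult_left_mono)
      also have "\<dots> \<le> 2 * x" using t assms(2) by (intro mult_right_mono)
      finally show ?thesis .
    qed
    ultimately show ?thesis using c0 by (simp add: ln_div)
  qed
qed

text \<open>Negative part of the weighted logarithm, kept in \<open>ennreal\<close> so that it is
  infinite where w vanishes and cos < 1.\<close>

definition neg_log :: "(real \<Rightarrow> real) \<Rightarrow> real \<Rightarrow> ennreal" where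
  "neg_log w \<theta> = e2ennreal (- (ereal (1 - cos \<theta>) * ext_log (w \<theta>)))"

section \<open>The logarithmic integral of a Lebesgue decomposition\<close>

context nontrivial_circle_measure
begin

context
  fixes w :: "real \<Rightarrow> real" and \<mu>\<^sub>s :: "complex measure"
  assumes dec: "circle_Lebesgue_decomposition M w \<mu>\<^sub>s"
begin

lemma measurable_w [measurable]: "w \<in> borel_measurable borel"
  using dec by (simp add: circle_Lebesgue_decomposition_def)

lemma AE_w_nonneg: "AE \<theta> in angle_measure. 0 \<le> w \<theta>"
  using dec by (intro eventually_mono[OF AE_angle_measure]) (simp add: circle_Lebesgue_decomposition_def)

lemma sets_singular: "sets \<mu>\<^sub>s = sets M"
  using dec by (simp add: circle_Lebesgue_decomposition_def sets_M)

lemma nn_integral_decomposition: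
  assumes "f \<in> borel_measurable circle_borel"
  shows "(\<integral>\<^sup>+z. f z \<partial>M) = (\<integral>\<^sup>+\<theta>. ennreal (w \<theta>) * f (cis \<theta>) \<partial>angle_measure) + (\<integral>\<^sup>+z. f z \<partial>\<mu>\<^sub>s)"
proof -
  have "f \<in> borel_measurable M" using assms measurable_cong_sets[OF sets_M refl] by auto
  then have "(\<integral>\<^sup>+z. f z \<partial>M) = (\<integral>\<^sup>+z. f z \<partial>circle_ac w) + (\<integral>\<^sup>+z. f z \<partial>\<mu>\<^sub>s)"
    using dec by (intro nn_integral_emeasure_add) (auto simp: circle_Lebesgue_decomposition_def sets_M)
  then show ?thesis using nn_integral_circle_ac[OF measurable_w assms] by simp
qed

lemma decomposition_mass:
  "(\<integral>\<^sup>+\<theta>. ennreal (w \<theta>) \<partial>angle_measure) \<le> 1" "(\<integral>\<^sup>+z. 1 \<partial>\<mu>\<^sub>s) \<le> 1"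
proof -
  have "(\<integral>\<^sup>+z. 1 \<partial>M) = 1" by (simp add: emeasure_space_1)
  then have "(\<integral>\<^sup>+\<theta>. ennreal (w \<theta>) \<partial>angle_measure) + (\<integral>\<^sup>+z. 1 \<partial>\<mu>\<^sub>s) = 1"
    using nn_integral_decomposition[of "\<lambda>_. 1"] by simp
  then show "(\<integral>\<^sup>+\<theta>. ennreal (w \<theta>) \<partial>angle_measure) \<le> 1" "(\<integral>\<^sup>+z. 1 \<partial>\<mu>\<^sub>s) \<le> 1"
    by (metis le_iff_add, metis le_iff_add add.commute)
qed

lemma integrable_w: "integrable angle_measure w" "(\<integral>\<theta>. w \<theta> \<partial>angle_measure) \<le> 1"
proof -
  have "(\<integral>\<^sup>+\<theta>. ennreal (norm (w \<theta>)) \<partial>angle_measure) = (\<integral>\<^sup>+\<theta>. ennreal (w \<theta>) \<partial>angle_measure)"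
    using AE_w_nonneg by (intro nn_integral_cong_AE) (auto elim: eventually_mono)
  then have "(\<integral>\<^sup>+\<theta>. ennreal (norm (w \<theta>)) \<partial>angle_measure) < \<infinity>"
    using decomposition_mass(1) by (simp add: order_le_less_trans[OF _ ennreal_one_less_top])
  then show i: "integrable angle_measure w" by (intro integrableI_bounded) auto
  have "ennreal (\<integral>\<theta>. w \<theta> \<partial>angle_measure) \<le> ennreal 1"
    using nn_integral_eq_integral[OF i AE_w_nonneg] decomposition_mass(1) by simp
  then show "(\<integral>\<theta>. w \<theta> \<partial>angle_measure) \<le> 1" by (subst (asm) ennreal_le_iff) auto
qed

lemma measurable_neg_log: "neg_log w \<in> borel_measurable borel"
proof -
  have [measurable]: "(\<lambda>\<theta>. ext_log (w \<theta>)) \<in> borel_measurable borel"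
    using measurable_compose[OF measurable_w measurable_ext_log] .
  show ?thesis unfolding neg_log_def[abs_def] by measurable
qed

text \<open>The positive part integrates to at most 2, so the difference in
  \<open>ext_integral\<close> is never infinity minus infinity and can be -infinity only through the
  negative part.\<close>

lemma ext_integral_log_iff:
  "ext_integral angle_measure (\<lambda>\<theta>. ereal (1 - cos \<theta>) * ext_log (w \<theta>)) > - \<infinity>
    \<longleftrightarrow> (\<integral>\<^sup>+\<theta>. neg_log w \<theta> \<partial>angle_measure) < \<infinity>"
proof -
  have "(\<integral>\<^sup>+\<theta>. e2ennreal (ereal (1 - cos \<theta>) * ext_log (w \<theta>)) \<partial>angle_measure) \<le> (\<integral>\<^sup>+\<theta>. ennreal (2 * w \<theta>) \<partial>angle_measure)"
    using AE_w_nonneg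
    by (intro nn_integral_mono_AE, elim eventually_mono) (intro e2ennreal_log_le one_minus_cos_bounds)
  also have "\<dots> = 2 * (\<integral>\<^sup>+\<theta>. ennreal (w \<theta>) \<partial>angle_measure)"
    by (subst nn_integral_cmult[symmetric]) (auto simp: ennreal_mult')
  also have "\<dots> \<le> 2 * 1" by (intro mult_left_mono decomposition_mass) auto
  also have "\<dots> < \<infinity>" by simp
  finally obtain p where p: "0 \<le> p" "(\<integral>\<^sup>+\<theta>. e2ennreal (ereal (1 - cos \<theta>) * ext_log (w \<theta>)) \<partial>angle_measure) = ennreal p"
    by (auto simp: less_top_ennreal)
  show ?thesis
    unfolding ext_integral_def p(2) neg_log_def
    by (cases "(\<integral>\<^sup>+\<theta>. e2ennreal (- (ereal (1 - cos \<theta>) * ext_log (w \<theta>))) \<partial>angle_measure)" rule: ennreal_cases)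
      (use p(1) in \<open>auto simp: less_top[symmetric]\<close>)
qed

text \<open>|Phi_n|^2 divided by its norm \<open>szego_norm alpha n\<close> has integral 1 under
  \<open>M\<close>, so w / w_n has integral at most 1 over the angle. Then ln x <= x - 1 at x = w /
  w_n compares the two logarithmic integrals.\<close>

lemma log_integral_bound:
  assumes fin: "(\<integral>\<^sup>+\<theta>. neg_log w \<theta> \<partial>angle_measure) < \<infinity>"
  shows "\<exists>L. \<forall>n. L \<le> (\<integral>\<theta>. (1 - cos \<theta>) * ln (bs_weight alpha n \<theta>) \<partial>angle_measure)"
proof -
  let ?h = "\<lambda>\<theta>. (1 - cos \<theta>) * ln (w \<theta>)"
  have "AE \<theta> in angle_measure. neg_log w \<theta> \<noteq> \<infinity>"
    using fin measurable_neg_log by (intro nn_integral_noteq_infinite) (auto simp: less_top[symmetric])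
  \<comment> \<open>As \<open>ln 0 = 0\<close> in HOL, positivity is what makes the real
    \<open>ln\<close> of w the true logarithm almost everywhere below.\<close>
  then have wpos: "AE \<theta> in angle_measure. 0 < w \<theta>"
    using AE_cos_less_1
  proof eventually_elim
    case (elim \<theta>)
    show ?case
    proof (rule ccontr)
      assume "\<not> 0 < w \<theta>"
      then show False using elim by (simp add: neg_log_def ext_log_def)
    qed
  qed
  have ih: "integrable angle_measure ?h"
  proof (rule integrableI_bounded)
    have "(\<integral>\<^sup>+\<theta>. ennreal (norm (?h \<theta>)) \<partial>angle_measure) \<le> (\<integral>\<^sup>+\<theta>. neg_log w \<theta> + 2 * ennreal (w \<theta>) \<partial>angle_measure)"
    proof (rule nn_integral_mono_AE)
      show "AE \<theta> in angle_measure. ennreal (norm (?h \<theta>)) \<le> neg_log w \<theta> + 2 * ennreal (w \<theta>)"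
        using wpos
      proof eventually_elim
        case (elim \<theta>)
        have "?h \<theta> \<le> 2 * w \<theta>"
        proof -
          have "ln (w \<theta>) \<le> w \<theta>" using elim ln_le_minus_one[of "w \<theta>"] by linarith
          then have "?h \<theta> \<le> (1 - cos \<theta>) * w \<theta>" by (intro mult_left_mono one_minus_cos_bounds)
          also have "\<dots> \<le> 2 * w \<theta>" using elim by (intro mult_right_mono one_minus_cos_bounds) auto
          finally show ?thesis .
        qed
        then have "norm (?h \<theta>) \<le> max 0 (- ?h \<theta>) + 2 * w \<theta>" using elim by auto
        then have "ennreal (norm (?h \<theta>)) \<le> ennreal (max 0 (- ?h \<theta>)) + ennreal (2 * w \<theta>)"
          using elim by (subst ennreal_plus[symmetric]) (simp_all only: ennreal_leI max.cobounded1 mult_nonneg_nonneg less_imp_le zero_le_numeral)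
        also have "ennreal (max 0 (- ?h \<theta>)) = neg_log w \<theta>"
          using elim by (simp add: neg_log_def e2ennreal_neg_log max_def ennreal_neg)
        also have "ennreal (2 * w \<theta>) = 2 * ennreal (w \<theta>)" using elim by (simp add: ennreal_mult')
        finally show ?case .
      qed
    qed
    also have "\<dots> = (\<integral>\<^sup>+\<theta>. neg_log w \<theta> \<partial>angle_measure) + 2 * (\<integral>\<^sup>+\<theta>. ennreal (w \<theta>) \<partial>angle_measure)"
      using measurable_neg_log by (subst nn_integral_add) (auto simp: nn_integral_cmult)
    also have "\<dots> \<le> (\<integral>\<^sup>+\<theta>. neg_log w \<theta> \<partial>angle_measure) + 2 * 1"
      by (intro add_left_mono mult_left_mono decomposition_mass) auto
    also have "\<dots> < \<infinity>" using fin by (simp add: less_top[symmetric])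
    finally show "(\<integral>\<^sup>+\<theta>. ennreal (norm (?h \<theta>)) \<partial>angle_measure) < \<infinity>" .
  qed measurable
  \<comment> \<open>The weighted integral of x - 1 is at most \<open>2 * 1 - 1 = 1\<close>, the
    constant subtracted here.\<close>
  have "(\<integral>\<theta>. ?h \<theta> \<partial>angle_measure) - 1 \<le> (\<integral>\<theta>. (1 - cos \<theta>) * ln (bs_weight alpha n \<theta>) \<partial>angle_measure)" for n
  proof -
    let ?v = "bs_weight alpha n"
    have vpos: "?v \<theta> > 0" for \<theta> by (intro bs_weight_pos verblunsky_less_1)
    have vc: "continuous_on S ?v" for S by (intro continuous_bs_weight verblunsky_less_1)
    have [measurable]: "?v \<in> borel_measurable borel" by (rule borel_measurable_continuous_onI[OF vc])
    have Npos: "szego_norm alpha n > 0" by (intro szego_norm_pos verblunsky_less_1)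
    have quot: "w \<theta> / ?v \<theta> = w \<theta> * (cmod (poly (Phi alpha n) (cis \<theta>)))\<^sup>2 / szego_norm alpha n" for \<theta>
      by (simp add: bs_weight_def)
    have qpos: "AE \<theta> in angle_measure. 0 \<le> w \<theta> / ?v \<theta>"
      using wpos by eventually_elim (use vpos in \<open>simp add: less_imp_le\<close>)
    have "(\<lambda>z. ennreal ((cmod (poly (Phi alpha n) z))\<^sup>2 / szego_norm alpha n)) \<in> borel_measurable circle_borel"
      unfolding circle_borel_def
      by (intro measurable_compose[OF _ measurable_ennreal] borel_measurable_continuous_on_restrict continuous_intros) (use Npos in auto)
    then have "(\<integral>\<^sup>+\<theta>. ennreal (w \<theta>) * ennreal ((cmod (poly (Phi alpha n) (cis \<theta>)))\<^sup>2 / szego_norm alpha n) \<partial>angle_measure)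
        \<le> (\<integral>\<^sup>+z. ennreal ((cmod (poly (Phi alpha n) z))\<^sup>2 / szego_norm alpha n) \<partial>M)"
      by (subst nn_integral_decomposition) auto
    also have "\<dots> = ennreal (\<integral>z. (cmod (poly (Phi alpha n) z))\<^sup>2 / szego_norm alpha n \<partial>M)"
      using Npos by (intro nn_integral_eq_integral integrable_continuous continuous_intros) auto
    also have "\<dots> = 1" using integral_norm_Phi[of n] Npos by simp
    also have "(\<integral>\<^sup>+\<theta>. ennreal (w \<theta>) * ennreal ((cmod (poly (Phi alpha n) (cis \<theta>)))\<^sup>2 / szego_norm alpha n) \<partial>angle_measure)
      = (\<integral>\<^sup>+\<theta>. ennreal (w \<theta> / ?v \<theta>) \<partial>angle_measure)"
      using wpos Npos unfolding quot
      by (intro nn_integral_cong_AE) (auto elim!: eventually_mono simp: ennreal_mult[symmetric] divide_nonneg_pos)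
    finally have q1: "(\<integral>\<^sup>+\<theta>. ennreal (w \<theta> / ?v \<theta>) \<partial>angle_measure) \<le> 1" .
    have "(\<integral>\<^sup>+\<theta>. ennreal (norm (w \<theta> / ?v \<theta>)) \<partial>angle_measure) = (\<integral>\<^sup>+\<theta>. ennreal (w \<theta> / ?v \<theta>) \<partial>angle_measure)"
      using qpos by (intro nn_integral_cong_AE) (auto elim!: eventually_mono simp del: abs_divide)
    then have "(\<integral>\<^sup>+\<theta>. ennreal (norm (w \<theta> / ?v \<theta>)) \<partial>angle_measure) < \<infinity>"
      using q1 by (simp add: order_le_less_trans[OF _ ennreal_one_less_top])
    then have iq: "integrable angle_measure (\<lambda>\<theta>. w \<theta> / ?v \<theta>)" by (intro integrableI_bounded) measurable
    have "ennreal (\<integral>\<theta>. w \<theta> / ?v \<theta> \<partial>angle_measure) \<le> ennreal 1"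
      using nn_integral_eq_integral[OF iq qpos] q1 by simp
    then have q2: "(\<integral>\<theta>. w \<theta> / ?v \<theta> \<partial>angle_measure) \<le> 1" by (subst (asm) ennreal_le_iff) auto
    have icq: "integrable angle_measure (\<lambda>\<theta>. (1 - cos \<theta>) * (w \<theta> / ?v \<theta>))"
    proof (rule Bochner_Integration.integrable_bound[OF integrable_mult_right[OF iq, of 2]])
      have "\<bar>1 - cos \<theta>\<bar> * \<bar>x\<bar> \<le> 2 * \<bar>x\<bar>" for \<theta> x :: real
        using one_minus_cos_bounds[of \<theta>] by (intro mult_right_mono) auto
      then have "norm ((1 - cos \<theta>) * x) \<le> norm (2 * x)" for \<theta> x :: real
        by (simp add: abs_mult)
      then show "AE \<theta> in angle_measure. norm ((1 - cos \<theta>) * (w \<theta> / ?v \<theta>)) \<le> norm (2 * (w \<theta> / ?v \<theta>))"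
        by (intro AE_I2)
    qed measurable
    have iv: "integrable angle_measure (\<lambda>\<theta>. (1 - cos \<theta>) * ln (?v \<theta>))"
      using vpos by (intro integrable_angle_continuous continuous_intros vc) (auto simp: less_imp_neq[symmetric])
    have ic: "integrable angle_measure (\<lambda>\<theta>. 1 - cos \<theta>)"
      by (intro integrable_angle_continuous continuous_intros)
    have "(\<integral>\<theta>. ?h \<theta> - (1 - cos \<theta>) * ln (?v \<theta>) \<partial>angle_measure)
        \<le> (\<integral>\<theta>. (1 - cos \<theta>) * (w \<theta> / ?v \<theta>) - (1 - cos \<theta>) \<partial>angle_measure)"
    proof (rule integral_mono_AE)
      show "AE \<theta> in angle_measure. ?h \<theta> - (1 - cos \<theta>) * ln (?v \<theta>) \<le> (1 - cos \<theta>) * (w \<theta> / ?v \<theta>) - (1 - cos \<theta>)"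
        using wpos
      proof eventually_elim
        case (elim \<theta>)
        have "ln (w \<theta>) - ln (?v \<theta>) \<le> w \<theta> / ?v \<theta> - 1"
          using ln_le_minus_one[of "w \<theta> / ?v \<theta>"] elim vpos[of \<theta>] by (simp add: ln_div)
        then have "(1 - cos \<theta>) * (ln (w \<theta>) - ln (?v \<theta>)) \<le> (1 - cos \<theta>) * (w \<theta> / ?v \<theta> - 1)"
          by (intro mult_left_mono one_minus_cos_bounds)
        then show ?case by (simp only: right_diff_distrib mult_1_right)
      qed
    qed (intro Bochner_Integration.integrable_diff ih iv icq ic)+
    also have "\<dots> = (\<integral>\<theta>. (1 - cos \<theta>) * (w \<theta> / ?v \<theta>) \<partial>angle_measure) - 1"
      by (subst Bochner_Integration.integral_diff[OF icq ic]) (simp only: integral_one_minus_cos)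
    also have "\<dots> \<le> 2 * (\<integral>\<theta>. w \<theta> / ?v \<theta> \<partial>angle_measure) - 1"
      using integral_weight_le[OF qpos iq icq] by linarith
    also have "\<dots> \<le> 1" using q2 by linarith
    finally show ?thesis by (subst (asm) Bochner_Integration.integral_diff[OF ih iv]) linarith
  qed
  then show ?thesis by blast
qed

text \<open>For each k the test function is the inverse of the clipped w, made small on a null set
  carrying the singular part. Its integral against \<open>M\<close> is at most 3, so
  \<open>integral_ge_log\<close> bounds the truncated logarithms uniformly in k, and monotone
  convergence concludes.\<close>

lemma neg_log_finite:
  assumes L: "\<And>n. L \<le> (\<integral>\<theta>. (1 - cos \<theta>) * ln (bs_weight alpha n \<theta>) \<partial>angle_measure)"
  shows "(\<integral>\<^sup>+\<theta>. neg_log w \<theta> \<partial>angle_measure) < \<infinity>"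
proof -
  obtain S where S: "S \<in> sets \<mu>\<^sub>s" "emeasure \<mu>\<^sub>s S = 0"
    "emeasure (circle_ac (\<lambda>_. 1)) (space (circle_ac (\<lambda>_. 1)) - S) = 0"
    using dec unfolding circle_Lebesgue_decomposition_def mutually_singular_def by blast
  \<comment> \<open>\<open>S\<close> is null for the singular part and its complement is null for
    arc length, so \<open>T\<close> carries the singular part at no cost to arc length.\<close>
  define T where "T = sphere 0 1 - S"
  have spac: "space (circle_ac (\<lambda>_. 1)) = sphere 0 1"
    by (simp add: circle_ac_def circle_borel_def space_restrict_space)
  have TM: "T \<in> sets circle_borel"
    using sets.compl_sets[OF S(1)] sets_singular sets_M space_M sets_eq_imp_space_eq[OF sets_singular] by (simp add: T_def)
  have Tb [measurable]: "T \<in> sets borel"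
    using TM unfolding circle_borel_def by (subst (asm) sets_restrict_space_iff) auto
  have "(\<integral>\<^sup>+\<theta>. ennreal 1 * indicator T (cis \<theta>) \<partial>angle_measure) = emeasure (circle_ac (\<lambda>_. 1)) T"
    using TM by (subst nn_integral_circle_ac[symmetric]) auto
  also have "\<dots> = 0" using S(3) by (simp add: spac T_def)
  finally have z: "(\<integral>\<^sup>+\<theta>. indicator T (cis \<theta>) \<partial>angle_measure) = 0" by simp
  have [measurable]: "cis \<in> borel_measurable borel"
    by (intro borel_measurable_continuous_onI continuous_intros)
  have T0: "AE \<theta> in angle_measure. cis \<theta> \<notin> T"
    using z by (subst (asm) nn_integral_0_iff_AE) (auto elim!: eventually_mono simp: indicator_def)
  have sS: "AE z in \<mu>\<^sub>s. z \<in> T"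
  proof (rule AE_I[OF _ S(2) S(1)])
    show "{z \<in> space \<mu>\<^sub>s. z \<notin> T} \<subseteq> S"
      using sets_eq_imp_space_eq[OF sets_singular] by (auto simp: T_def space_M)
  qed
  define g where "g k \<theta> = (1 - cos \<theta>) * max 0 (- ln (max (1 / real (Suc k)) (w \<theta>)))" for k \<theta>
  have [measurable]: "g k \<in> borel_measurable borel" for k unfolding g_def[abs_def] by measurable
  \<comment> \<open>From \<open>key\<close> with the integral of f at most 3, the logarithmic
    integral is at most 6 - 1 - L; twice the mass of w adds at most 2.\<close>
  have bound: "(\<integral>\<^sup>+\<theta>. ennreal (g k \<theta>) \<partial>angle_measure) \<le> ennreal (7 - L)" for k
  proof -
    let ?K = "real (Suc k)"
    define c where "c \<theta> = max (1 / ?K) (min ?K (w \<theta>))" for \<theta>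
    \<comment> \<open>The value on \<open>T\<close> is the smallest the clipping range allows: it
      keeps the singular contribution at most its mass, while f is still \<open>1 / c\<close> for
      almost every angle.\<close>
    define f where "f z = (if z \<in> T then 1 / ?K else 1 / c (circle_arg z))" for z
    have K: "?K \<ge> 1" by simp
    then have K1: "0 < 1 / ?K" "1 / ?K \<le> 1" by simp_all
    have cm [measurable]: "c \<in> borel_measurable borel" unfolding c_def[abs_def] by measurable
    have fm [measurable]: "f \<in> borel_measurable borel" unfolding f_def[abs_def] by measurable
    have cb: "1 / ?K \<le> c \<theta>" "c \<theta> \<le> ?K" for \<theta> unfolding c_def using K K1(2) by linarith+
    have fb: "1 / ?K \<le> f z" "f z \<le> ?K" for z
    proof -
      have c0: "c \<theta> > 0" for \<theta> using cb(1)[of \<theta>] K1 by linarith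
      have "1 / ?K \<le> 1 / c \<theta>" for \<theta> using cb(2)[of \<theta>] c0[of \<theta>] by (intro divide_left_mono) auto
      then show "1 / ?K \<le> f z" by (simp add: f_def)
      have "1 / c \<theta> \<le> ?K" for \<theta>
      proof -
        have "1 \<le> ?K * c \<theta>" using cb(1)[of \<theta>] by (simp add: field_simps)
        then show ?thesis using c0[of \<theta>] by (simp add: field_simps)
      qed
      moreover have "1 / ?K \<le> ?K" using K K1(2) by linarith
      ultimately show "f z \<le> ?K" unfolding f_def by presburger
    qed
    have fcis: "AE \<theta> in angle_measure. f (cis \<theta>) = 1 / c \<theta>"
      using T0 AE_angle_measure by eventually_elim (simp add: f_def circle_arg_cis)
    have fM: "(\<lambda>z. ennreal (f z)) \<in> borel_measurable circle_borel"
      unfolding circle_borel_def by (intro measurable_restrict_space1) measurable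
    have "(\<integral>\<^sup>+z. ennreal (f z) \<partial>M) =
       (\<integral>\<^sup>+\<theta>. ennreal (w \<theta>) * ennreal (f (cis \<theta>)) \<partial>angle_measure) + (\<integral>\<^sup>+z. ennreal (f z) \<partial>\<mu>\<^sub>s)"
      by (rule nn_integral_decomposition[OF fM])
    \<comment> \<open>Uses w / c <= 1 + w on the absolutely continuous side and f <= 1 on the
      singular side; the masses of arc length, w and the singular part are each at most 1.\<close>
    also have "\<dots> \<le> (\<integral>\<^sup>+\<theta>. 1 + ennreal (w \<theta>) \<partial>angle_measure) + (\<integral>\<^sup>+z. 1 \<partial>\<mu>\<^sub>s)"
    proof (intro add_mono nn_integral_mono_AE)
      show "AE z in \<mu>\<^sub>s. ennreal (f z) \<le> 1"
        using sS by eventually_elim (simp add: f_def)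
      show "AE \<theta> in angle_measure. ennreal (w \<theta>) * ennreal (f (cis \<theta>)) \<le> 1 + ennreal (w \<theta>)"
        using fcis AE_w_nonneg
      proof eventually_elim
        case (elim \<theta>)
        have "w \<theta> * (1 / c \<theta>) \<le> 1 + w \<theta>" unfolding c_def by (rule inverse_clip_bounds(4)[OF K elim(2)])
        then have "ennreal (w \<theta> * (1 / c \<theta>)) \<le> ennreal (1 + w \<theta>)" by (rule ennreal_leI)
        moreover have "0 \<le> 1 / c \<theta>" using fb(1)[of "cis \<theta>"] K1 unfolding elim by linarith
        ultimately show ?case using elim by (simp add: ennreal_mult[symmetric])
      qed
    qed
    also have "\<dots> = 1 + (\<integral>\<^sup>+\<theta>. ennreal (w \<theta>) \<partial>angle_measure) + (\<integral>\<^sup>+z. 1 \<partial>\<mu>\<^sub>s)"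
      by (subst nn_integral_add) (auto simp: angle.emeasure_space_1[unfolded space_angle_measure])
    also have "\<dots> \<le> 1 + 1 + 1" by (intro add_mono decomposition_mass order_refl)
    finally have "(\<integral>\<^sup>+z. ennreal (f z) \<partial>M) \<le> 3" by simp
    moreover have "(\<integral>\<^sup>+z. ennreal (f z) \<partial>M) = ennreal (\<integral>z. f z \<partial>M)"
    proof (rule nn_integral_eq_integral)
      have f0: "0 \<le> f z" for z using fb(1)[of z] K1 by linarith
      then show "AE z in M. 0 \<le> f z" by simp
      show "integrable M f"
        using f0 fb(2) measurable_M[OF fm] by (intro integrable_const_bound[where B="?K"]) auto
    qed
    ultimately have "ennreal (\<integral>z. f z \<partial>M) \<le> ennreal 3" by simp
    then have f3: "(\<integral>z. f z \<partial>M) \<le> 3" by (subst (asm) ennreal_le_iff) auto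
    have key: "1 + (\<integral>\<theta>. (1 - cos \<theta>) * ln (f (cis \<theta>)) \<partial>angle_measure) + L \<le> 2 * (\<integral>z. f z \<partial>M)"
      by (rule integral_ge_log[OF L fm K1(1) fb])
    have ilf: "integrable angle_measure (\<lambda>\<theta>. (1 - cos \<theta>) * ln (f (cis \<theta>)))"
      by (rule integrable_log_bounded[OF _ K1(1) fb]) measurable
    have g0: "0 \<le> g k \<theta>" for \<theta> unfolding g_def by (intro mult_nonneg_nonneg one_minus_cos_bounds) auto
    have le: "AE \<theta> in angle_measure. g k \<theta> \<le> (1 - cos \<theta>) * ln (f (cis \<theta>)) + 2 * w \<theta>"
      using fcis AE_w_nonneg
    proof eventually_elim
      case (elim \<theta>)
      show ?case unfolding g_def elim(1) c_def
        by (rule inverse_clip_bounds(5)[OF K elim(2) one_minus_cos_bounds])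
    qed
    have ib: "integrable angle_measure (\<lambda>\<theta>. (1 - cos \<theta>) * ln (f (cis \<theta>)) + 2 * w \<theta>)"
      using ilf integrable_w(1) by auto
    have "(\<integral>\<^sup>+\<theta>. ennreal (g k \<theta>) \<partial>angle_measure) \<le> (\<integral>\<^sup>+\<theta>. ennreal ((1 - cos \<theta>) * ln (f (cis \<theta>)) + 2 * w \<theta>) \<partial>angle_measure)"
      using le by (intro nn_integral_mono_AE) (auto elim!: eventually_mono intro: ennreal_leI)
    also have "\<dots> = ennreal (\<integral>\<theta>. (1 - cos \<theta>) * ln (f (cis \<theta>)) + 2 * w \<theta> \<partial>angle_measure)"
      by (intro nn_integral_eq_integral[OF ib] eventually_mono[OF le]) (use g0 order_trans in blast)
    also have "\<dots> \<le> ennreal (7 - L)"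
    proof (rule ennreal_leI)
      have "(\<integral>\<theta>. (1 - cos \<theta>) * ln (f (cis \<theta>)) + 2 * w \<theta> \<partial>angle_measure) =
          (\<integral>\<theta>. (1 - cos \<theta>) * ln (f (cis \<theta>)) \<partial>angle_measure) + 2 * (\<integral>\<theta>. w \<theta> \<partial>angle_measure)"
        using ilf integrable_w(1) by (subst Bochner_Integration.integral_add) auto
      then show "(\<integral>\<theta>. (1 - cos \<theta>) * ln (f (cis \<theta>)) + 2 * w \<theta> \<partial>angle_measure) \<le> 7 - L"
        using key f3 integrable_w(2) by linarith
    qed
    finally show ?thesis .
  qed
  have inc: "incseq (\<lambda>k \<theta>. ennreal (g k \<theta>))"
  proof (rule incseq_SucI, rule le_funI, rule ennreal_leI)
    fix k \<theta>
    have "1 / real (Suc (Suc k)) \<le> 1 / real (Suc k)" by (simp add: field_simps)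
    then have "max (1 / real (Suc (Suc k))) (w \<theta>) \<le> max (1 / real (Suc k)) (w \<theta>)" by linarith
    moreover have "0 < max (1 / real (Suc (Suc k))) (w \<theta>)" by (simp add: less_max_iff_disj)
    ultimately have "ln (max (1 / real (Suc (Suc k))) (w \<theta>)) \<le> ln (max (1 / real (Suc k)) (w \<theta>))" by (rule ln_mono)
    then show "g k \<theta> \<le> g (Suc k) \<theta>"
      unfolding g_def by (intro mult_left_mono one_minus_cos_bounds) linarith
  qed
  have "(\<integral>\<^sup>+\<theta>. neg_log w \<theta> \<partial>angle_measure) \<le> (\<integral>\<^sup>+\<theta>. (SUP k. ennreal (g k \<theta>)) \<partial>angle_measure)"
    unfolding neg_log_def g_def by (intro nn_integral_mono e2ennreal_neg_log_le_SUP one_minus_cos_bounds)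
  also have "\<dots> = (SUP k. \<integral>\<^sup>+\<theta>. ennreal (g k \<theta>) \<partial>angle_measure)"
    by (rule nn_integral_monotone_convergence_SUP[OF inc]) measurable
  also have "\<dots> \<le> ennreal (7 - L)" by (rule SUP_least) (rule bound)
  also have "\<dots> < \<infinity>" by simp
  finally show ?thesis .
qed

end

end

theorem theorem2p1:
  fixes \<mu> \<mu>\<^sub>s :: "complex measure" and w :: "real \<Rightarrow> real" and \<alpha> :: "nat \<Rightarrow> complex"
  assumes "nontrivial_circle_prob \<mu>"
    and "\<And>j. \<alpha> j = verblunsky \<mu> j"
    and "circle_Lebesgue_decomposition \<mu> w \<mu>\<^sub>s"
  shows "(\<Sum>j. ennreal (cmod (\<alpha> (j + 1) - \<alpha> j) ^ 2)) + (\<Sum>j. ennreal (cmod (\<alpha> j) ^ 4)) < \<infinity>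
    \<longleftrightarrow> ext_integral angle_measure (\<lambda>\<theta>. ereal (1 - cos \<theta>) * ext_log (w \<theta>)) > - \<infinity>"
proof -
  interpret prob_space \<mu> using assms(1) by (simp add: nontrivial_circle_prob_def circle_prob_def)
  interpret nontrivial_circle_measure \<mu>
    by unfold_locales (use assms(1) in \<open>simp_all add: nontrivial_circle_prob_def circle_prob_def\<close>)
  have \<alpha>: "\<alpha> = verblunsky \<mu>" using assms(2) by blast
  have a: "cmod (\<alpha> j) < 1" for j unfolding \<alpha> by (rule verblunsky_less_1)
  have Z: "ln (szego_norm \<alpha> n) + Re (coeff (Psi \<alpha> n) 1) =
      (\<integral>\<theta>. (1 - cos \<theta>) * ln (bs_weight (verblunsky \<mu>) n \<theta>) \<partial>angle_measure)" for n
    unfolding \<alpha> by (rule integral_log_bs_weight[symmetric]) (rule verblunsky_less_1)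
  show ?thesis
    unfolding sums_finite_iff_bounded_below[of \<alpha>, OF a] Z ext_integral_log_iff[OF assms(3)]
    using log_integral_bound[OF assms(3)] neg_log_finite[OF assms(3)] by blast
qed

end
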